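(* Let $\mathbb{F}$ be a field, let $m,n,d$ be positive integers, let $P(\lambda)\in\mathbb{F}[\lambda]^{m\times n}_d$, and let $r$ be an integer with $0<r\le\min\{m,n\}$. Then $P(\lambda)$ has normal rank $r$, degree exactly $d$, and has no finite or infinite eigenvalues (the infinite eigenvalues being taken with respect to $d$) if and only if $P(\lambda)$ can be factorized as $P(\lambda)=L(\lambda)R(\lambda)$ with $L(\lambda)\in\mathbb{F}[\lambda]^{m\times r}$ and $R(\lambda)\in\mathbb{F}[\lambda]^{r\times n}$, where the columns of $L(\lambda)$ form a minimal basis (of the rational subspace they span), the rows of $R(\lambda)$ form a minimal basis (of the rational subspace they span), and $$\deg(L_{*i})+\deg(R_{i*})=d\quad\text{for } i=1,\dots,r.$$
   Context: $\mathbb{F}[\lambda]^{m\times n}_d$ denotes the set of $m\times n$ polynomial matrices over $\mathbb{F}$ of degree at most $d$; the degree of a polynomial vector or matrix is the maximum degree of its entries, and the zero polynomial has degree $-\infty$. $L_{*i}$ denotes the $i$th column of $L$ and $R_{i*}$ the $i$th row of $R$. The normal rank of a polynomial matrix is its rank over the field of rational functions $\mathbb{F}(\lambda)$. A rational subspace is a subspace of $\mathbb{F}(\lambda)^k$; a minimal basis of it is a basis consisting of polynomial vectors whose sum of degrees is minimal among all bases consisting of polynomial vectors. Invariant polynomials of $P$ are the nonzero diagonal entries $e_1|e_2|\cdots|e_r$ (monic, each dividing the next) of its Smith form, i.e. $P=U\,\mathrm{diag}(e_1,\dots,e_r,0)\,V$ with $U,V$ unimodular (square polynomial with nonzero constant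 determinant). A finite eigenvalue of $P$ is a root in the algebraic closure $\overline{\mathbb{F}}$ of some invariant polynomial. For $P\in\mathbb{F}[\lambda]^{m\times n}_d$, $P$ has an eigenvalue at $\infty$ (with respect to $d$) if $0$ is a finite eigenvalue of $\lambda^dP(1/\lambda)$. *)

theory Defs
  imports "Jordan_Normal_Form.DL_Rank" "HOL-Computational_Algebra.Polynomial_Factorial"
    "HOL-Library.Extended_Real"
begin

definition frac_vec :: "'a::field poly vec \<Rightarrow> 'a poly fract vec" where
  "frac_vec v = map_vec to_fract v"

definition frac_mat :: "'a::field poly mat \<Rightarrow> 'a poly fract mat" where
  "frac_mat A = map_mat to_fract A"

definition normal_rank :: "'a::field poly mat \<Rightarrow> nat" where
  "normal_rank P = vec_space.rank (dim_row P) (frac_mat P)"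

definition lin_indep_list :: "nat \<Rightarrow> 'b::field vec list \<Rightarrow> bool" where
  "lin_indep_list k vs \<longleftrightarrow>
     (\<forall>c :: nat \<Rightarrow> 'b. (\<forall>j<k. (\<Sum>i<length vs. c i * (vs ! i) $ j) = 0) \<longrightarrow> (\<forall>i<length vs. c i = 0))"

definition span_list :: "nat \<Rightarrow> 'b::field vec list \<Rightarrow> 'b vec set" where
  "span_list k vs = {vec k (\<lambda>j. \<Sum>i<length vs. c i * (vs ! i) $ j) | c :: nat \<Rightarrow> 'b. True}"

definition vec_deg :: "'a::field poly vec \<Rightarrow> ereal" where
  "vec_deg v = (if v = 0\<^sub>v (dim_vec v) then -\<infinity>
                else ereal (real (Max {degree (v $ i) | i. i < dim_vec v})))"

definition mat_deg :: "'a::field poly mat \<Rightarrow> ereal" where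
  "mat_deg P = (if P = 0\<^sub>m (dim_row P) (dim_col P) then -\<infinity>
                else ereal (real (Max {degree (P $$ (i, j)) | i j. i < dim_row P \<and> j < dim_col P})))"

definition minimal_basis :: "nat \<Rightarrow> 'a::field poly vec list \<Rightarrow> bool" where
  "minimal_basis k vs \<longleftrightarrow>
     set vs \<subseteq> carrier_vec k \<and>
     lin_indep_list k (map frac_vec vs) \<and>
     (\<forall>ws. set ws \<subseteq> carrier_vec k \<and> lin_indep_list k (map frac_vec ws) \<and>
           span_list k (map frac_vec ws) = span_list k (map frac_vec vs) \<longrightarrow>
           sum_list (map vec_deg vs) \<le> sum_list (map vec_deg ws))"

definition unimodular :: "'a::field poly mat \<Rightarrow> bool" where
  "unimodular U \<longleftrightarrow> dim_row U = dim_col U \<and> det U \<noteq> 0 \<and> degree (det U) = 0"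

definition smith_diag :: "nat \<Rightarrow> nat \<Rightarrow> 'a::field poly list \<Rightarrow> 'a poly mat" where
  "smith_diag m n es = mat m n (\<lambda>(i, j). if i = j \<and> i < length es then es ! i else 0)"

definition invariant_polys :: "'a::field poly mat \<Rightarrow> 'a poly list \<Rightarrow> bool" where
  "invariant_polys P es \<longleftrightarrow>
     length es \<le> min (dim_row P) (dim_col P) \<and>
     (\<forall>e\<in>set es. e \<noteq> 0 \<and> lead_coeff e = 1) \<and>
     (\<forall>i. Suc i < length es \<longrightarrow> es ! i dvd es ! Suc i) \<and>
     (\<exists>U V. U \<in> carrier_mat (dim_row P) (dim_row P) \<and> V \<in> carrier_mat (dim_col P) (dim_col P) \<and>
            unimodular U \<and> unimodular V \<and>
            P = U * smith_diag (dim_row P) (dim_col P) es * V)"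

text \<open>P has a finite eigenvalue iff some invariant polynomial has a root in the algebraic
  closure of the base field, i.e. iff some invariant polynomial is nonconstant.\<close>
definition has_finite_eigenvalue :: "'a::field poly mat \<Rightarrow> bool" where
  "has_finite_eigenvalue P \<longleftrightarrow> (\<exists>es. invariant_polys P es \<and> (\<exists>e\<in>set es. degree e > 0))"

text \<open>Reversal with respect to d: lambda^d P(1/lambda) (entries assumed of degree at most d).\<close>
definition rev_poly :: "nat \<Rightarrow> 'a::field poly \<Rightarrow> 'a poly" where
  "rev_poly d p = (\<Sum>i\<le>d. monom (coeff p i) (d - i))"

definition rev_mat :: "nat \<Rightarrow> 'a::field poly mat \<Rightarrow> 'a poly mat" where
  "rev_mat d P = map_mat (rev_poly d) P"

definition has_infinite_eigenvalue :: "nat \<Rightarrow> 'a::field poly mat \<Rightarrow> bool" where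
  "has_infinite_eigenvalue d P \<longleftrightarrow>
     (\<exists>es. invariant_polys (rev_mat d P) es \<and> (\<exists>e\<in>set es. poly e 0 = 0))"

end

theory Submission
  imports Defs "Jordan_Normal_Form.Column_Operations" "Subresultants.More_Homomorphisms"
begin

text \<open>
  The columns of \<open>L\<close> form a minimal basis iff \<open>L\<close> has a polynomial left inverse and is column
  reduced, i.e. the matrix of leading coefficients of its columns is injective. Both directions rest
  on the predictable degree property: for column reduced \<open>L\<close> with column degrees \<open>\<delta>\<close>, the degree of
  \<open>L t\<close> is the maximum of \<open>\<delta>\<^sub>j + deg t\<^sub>j\<close> over the nonzero \<open>t\<^sub>j\<close>.

  If \<open>P\<close> has rank \<open>r\<close> and no finite eigenvalue, its Smith form gives \<open>P = A B\<close> with \<open>A\<close> left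
  invertible and \<open>B\<close> right invertible. A unimodular \<open>W\<close> makes \<open>L = A W\<close> column reduced; put
  \<open>R = W\<^sup>-\<^sup>1 B\<close>. By predictable degrees, row \<open>i\<close> of \<open>R\<close> has degree at most \<open>d - \<delta>\<^sub>i\<close>, so that the reversal
  of \<open>P\<close> is the product of the columnwise reversal of \<open>L\<close> and the rowwise reversal of \<open>R\<close>. Absence of
  infinite eigenvalues means that the reversal of \<open>P\<close> keeps rank \<open>r\<close> at \<open>0\<close>, so the value at \<open>0\<close>
  of the reversal of \<open>R\<close>, which consists of the coefficients of degree \<open>d - \<delta>\<^sub>i\<close>, has full row rank.
  Conversely, if \<open>X P Y = 1\<close> with \<open>r\<close> rows, then every invariant polynomial divides
  \<open>det (X P Y) = 1\<close>; the same argument for the reversal, evaluated at \<open>0\<close>, excludes infinite eigenvalues.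
\<close>

section \<open>One-sided inverses and unimodular matrices\<close>

text \<open>Padding \<open>A\<close> with zero columns and \<open>B\<close> with zero rows to square
  matrices leaves the product unchanged, and the padded \<open>B\<close> has a zero row.\<close>

lemma det_mult_eq_0_of_inner_dim:
  fixes A B :: "'b::idom mat"
  assumes A: "A \<in> carrier_mat a b" and B: "B \<in> carrier_mat b a" and "b < a"
  shows "det (A * B) = 0"
proof -
  define A' where "A' = mat a a (\<lambda>(i,j). if j < b then A $$ (i,j) else 0)"
  define B' where "B' = mat a a (\<lambda>(i,j). if i < b then B $$ (i,j) else 0)"
  have A': "A' \<in> carrier_mat a a" and B': "B' \<in> carrier_mat a a"
    unfolding A'_def B'_def by auto
  have "A * B = A' * B'"
  proof (rule eq_matI)
    fix i j assume "i < dim_row (A' * B')" "j < dim_col (A' * B')"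
    then have ij: "i < a" "j < a" using A' B' by auto
    have "(A' * B') $$ (i,j) = (\<Sum>k<a. A' $$ (i,k) * B' $$ (k,j))"
      using ij A' B' by (simp add: scalar_prod_def atLeast0LessThan)
    also have "\<dots> = (\<Sum>k<b. A $$ (i,k) * B $$ (k,j))"
      using ij \<open>b < a\<close> by (intro sum.mono_neutral_cong_right) (auto simp: A'_def B'_def)
    also have "\<dots> = (A * B) $$ (i,j)"
      using ij A B by (simp add: scalar_prod_def atLeast0LessThan)
    finally show "(A * B) $$ (i,j) = (A' * B') $$ (i,j)" by simp
  qed (use A B A' B' in auto)
  moreover have "det B' = 0"
    using \<open>b < a\<close> by (subst laplace_expansion_row[OF B', of b]) (simp_all add: B'_def)
  ultimately show ?thesis using det_mult[OF A' B'] by simp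
qed

lemma inner_dim_ge_of_mult_det_nonzero:
  fixes A B :: "'b::idom mat"
  assumes "A \<in> carrier_mat a b" "B \<in> carrier_mat b a" "det (A * B) \<noteq> 0"
  shows "a \<le> b"
  using det_mult_eq_0_of_inner_dim assms not_le_imp_less by blast

text \<open>For a polynomial matrix this means full column rank at every point of the algebraic
  closure, hence it is stronger than \<open>injective_mat\<close>, which is full column rank over
  the rational functions.\<close>

definition left_invertible :: "'b::comm_ring_1 mat \<Rightarrow> bool" where
  "left_invertible A \<longleftrightarrow> (\<exists>X \<in> carrier_mat (dim_col A) (dim_row A). X * A = 1\<^sub>m (dim_col A))"

definition right_invertible :: "'b::comm_ring_1 mat \<Rightarrow> bool" where
  "right_invertible A \<longleftrightarrow> (\<exists>Y \<in> carrier_mat (dim_col A) (dim_row A). A * Y = 1\<^sub>m (dim_row A))"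

definition injective_mat :: "'b::comm_ring_1 mat \<Rightarrow> bool" where
  "injective_mat A \<longleftrightarrow>
     (\<forall>v \<in> carrier_vec (dim_col A). A *\<^sub>v v = 0\<^sub>v (dim_row A) \<longrightarrow> v = 0\<^sub>v (dim_col A))"

lemma left_invertible_transpose:
  "left_invertible (transpose_mat A) \<longleftrightarrow> right_invertible (A :: 'b::comm_ring_1 mat)"
proof
  assume "left_invertible (transpose_mat A)"
  then obtain X where X: "X \<in> carrier_mat (dim_row A) (dim_col A)"
    "X * transpose_mat A = 1\<^sub>m (dim_row A)" unfolding left_invertible_def by auto
  then have "A * transpose_mat X = 1\<^sub>m (dim_row A)"
    using transpose_mult[of X "dim_row A" "dim_col A" "transpose_mat A" "dim_row A"] by simp
  then show "right_invertible A" using X unfolding right_invertible_def by auto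
next
  assume "right_invertible A"
  then obtain X where X: "X \<in> carrier_mat (dim_col A) (dim_row A)"
    "A * X = 1\<^sub>m (dim_row A)" unfolding right_invertible_def by auto
  then have "transpose_mat X * transpose_mat A = 1\<^sub>m (dim_row A)"
    using transpose_mult[of A "dim_row A" "dim_col A" X "dim_row A"] by simp
  then show "left_invertible (transpose_mat A)" using X unfolding left_invertible_def by auto
qed

lemma left_invertible_imp_injective:
  assumes "left_invertible A"
  shows "injective_mat A"
  unfolding injective_mat_def
proof (intro ballI impI)
  fix v assume v: "v \<in> carrier_vec (dim_col A)" and 0: "A *\<^sub>v v = 0\<^sub>v (dim_row A)"
  obtain X where X: "X \<in> carrier_mat (dim_col A) (dim_row A)" "X * A = 1\<^sub>m (dim_col A)"
    using assms unfolding left_invertible_def by auto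
  have "v = (X * A) *\<^sub>v v" using X v by simp
  also have "\<dots> = X *\<^sub>v (A *\<^sub>v v)" using X v by (intro assoc_mult_mat_vec) auto
  also have "\<dots> = 0\<^sub>v (dim_col A)" unfolding 0 using X by auto
  finally show "v = 0\<^sub>v (dim_col A)" .
qed

lemma left_invertible_mult:
  assumes "A \<in> carrier_mat a b" "B \<in> carrier_mat b c" "left_invertible A" "left_invertible B"
  shows "left_invertible (A * B)"
proof -
  obtain X where X: "X \<in> carrier_mat b a" "X * A = 1\<^sub>m b"
    using assms unfolding left_invertible_def by auto
  obtain Y where Y: "Y \<in> carrier_mat c b" "Y * B = 1\<^sub>m c"
    using assms unfolding left_invertible_def by auto
  have "(Y * X) * (A * B) = Y * (X * (A * B))"
    using X Y assms by (intro assoc_mult_mat) auto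
  also have "X * (A * B) = (X * A) * B"
    using X Y assms by (intro assoc_mult_mat[symmetric]) auto
  also have "Y * \<dots> = 1\<^sub>m c" using X Y assms by simp
  finally show ?thesis using X Y assms unfolding left_invertible_def 
    by (intro bexI[of _ "Y * X"]) auto
qed

lemma right_invertible_mult:
  assumes "A \<in> carrier_mat a b" "B \<in> carrier_mat b c" "right_invertible A" "right_invertible B"
  shows "right_invertible (A * B)"
  using left_invertible_mult[of "transpose_mat B" c b "transpose_mat A" a] assms
  by (simp add: left_invertible_transpose[symmetric] transpose_mult[of A a b B c])

lemma (in comm_ring_hom) left_invertible_map_mat:
  assumes "left_invertible A"
  shows "left_invertible (map_mat hom A)"
proof -
  obtain X where X: "X \<in> carrier_mat (dim_col A) (dim_row A)" "X * A = 1\<^sub>m (dim_col A)"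
    using assms unfolding left_invertible_def by auto
  have "map_mat hom X * map_mat hom A = 1\<^sub>m (dim_col A)"
    using X by (subst mat_hom_mult[symmetric]) (auto simp: mat_hom_one)
  then show ?thesis using X unfolding left_invertible_def by (auto intro!: bexI[of _ "map_mat hom X"])
qed

lemma (in comm_ring_hom) right_invertible_map_mat:
  assumes "right_invertible A"
  shows "right_invertible (map_mat hom A)"
  using left_invertible_map_mat[of "transpose_mat A"] assms
  by (simp add: left_invertible_transpose[symmetric] map_mat_transpose)

section \<open>Unimodular matrices and their inverses\<close>

lemma unimodular_one: "unimodular (1\<^sub>m n :: 'a::field poly mat)"
  by (simp add: unimodular_def)

lemma unimodular_mult:
  assumes "A \<in> carrier_mat n n" "B \<in> carrier_mat n n" "unimodular A" "unimodular B"
  shows "unimodular (A * B)"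
  using assms det_mult[OF assms(1,2)] by (auto simp: unimodular_def degree_mult_eq)

text \<open>The determinant is a nonzero constant, so dividing the adjugate by it stays within
  polynomial matrices.\<close>

lemma unimodular_inverse:
  fixes U :: "'a::field poly mat"
  assumes U: "U \<in> carrier_mat n n" and "unimodular U"
  obtains U' where "U' \<in> carrier_mat n n" "U' * U = 1\<^sub>m n" "U * U' = 1\<^sub>m n" "unimodular U'"
proof -
  obtain c where c: "det U = [:c:]" "c \<noteq> 0"
    using assms unfolding unimodular_def by (metis degree_eq_zeroE pCons_0_0)
  define U' where "U' = [:inverse c:] \<cdot>\<^sub>m adj_mat U"
  note adj = adj_mat[OF U]
  have 1: "U' \<in> carrier_mat n n" unfolding U'_def using adj by auto
  have c1: "[:inverse c:] * [:c:] = 1" using c by simp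
  have 2: "U' * U = 1\<^sub>m n"
    unfolding U'_def mult_smult_assoc_mat[OF adj(1) U] adj(3) c(1) using c1
    by (intro eq_matI) (simp_all del: mult_pCons_left mult_pCons_right)
  have 3: "U * U' = 1\<^sub>m n"
    unfolding U'_def mult_smult_distrib[OF U adj(1)] adj(2) c(1) using c1
    by (intro eq_matI) (simp_all del: mult_pCons_left mult_pCons_right)
  have "det U' * det U = 1" using det_mult[OF 1 U] 2 by simp
  then have 4: "det U' \<noteq> 0" "det U \<noteq> 0" by auto
  have "degree (det U') + degree (det U) = 0"
    using degree_mult_eq[OF 4] \<open>det U' * det U = 1\<close> by simp
  then have "unimodular U'" using 1 4 unfolding unimodular_def by auto
  with 1 2 3 show ?thesis using that by blast
qed

lemma unimodular_left_right_invertible: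
  assumes "unimodular (U :: 'a::field poly mat)"
  shows "left_invertible U" "right_invertible U"
proof -
  obtain n where U: "U \<in> carrier_mat n n" using assms by (auto simp: unimodular_def)
  obtain V where "V \<in> carrier_mat n n" "V * U = 1\<^sub>m n" "U * V = 1\<^sub>m n"
    using unimodular_inverse[OF U assms] .
  then show "left_invertible U" "right_invertible U"
    using U unfolding left_invertible_def right_invertible_def carrier_matD[OF U] by blast+
qed

lemma unimodular_four_block_diag:
  fixes U :: "'a::field poly mat"
  assumes "U \<in> carrier_mat n n" "unimodular U" "c \<noteq> 0"
  shows "unimodular (four_block_mat (mat 1 1 (\<lambda>_. [:c:])) (0\<^sub>m 1 n) (0\<^sub>m n 1) U)"
proof -
  let ?C = "mat 1 1 (\<lambda>_. [:c:])"
  have "det (four_block_mat ?C (0\<^sub>m 1 n) (0\<^sub>m n 1) U) = det ?C * det U"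
    by (rule det_four_block_mat_upper_right_zero) (use assms in auto)
  moreover have "det ?C = [:c:]" by (subst det_single) auto
  ultimately have det: "det (four_block_mat ?C (0\<^sub>m 1 n) (0\<^sub>m n 1) U) = [:c:] * det U" by metis
  have "[:c:] \<noteq> 0" using assms by simp
  then show ?thesis unfolding unimodular_def det using assms
    by (auto simp: unimodular_def)
qed

section \<open>Existence of the Smith form\<close>

definition unimod_equiv :: "'a::field poly mat \<Rightarrow> 'a poly mat \<Rightarrow> bool" where
  "unimod_equiv A B \<longleftrightarrow>
     (\<exists>U \<in> carrier_mat (dim_row A) (dim_row A). \<exists>V \<in> carrier_mat (dim_col A) (dim_col A).
        unimodular U \<and> unimodular V \<and> B = U * A * V)"

lemma unimod_equivI:
  assumes "A \<in> carrier_mat m n" "U \<in> carrier_mat m m" "V \<in> carrier_mat n n"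
    "unimodular U" "unimodular V" "B = U * A * V"
  shows "unimod_equiv A B"
  using assms unfolding unimod_equiv_def by auto

lemma unimod_equivE:
  assumes "unimod_equiv A B" "A \<in> carrier_mat m n"
  obtains U V where "U \<in> carrier_mat m m" "V \<in> carrier_mat n n"
    "unimodular U" "unimodular V" "B = U * A * V"
  using assms unfolding unimod_equiv_def by auto

lemma unimod_equiv_carrier:
  assumes "unimod_equiv A B" "A \<in> carrier_mat m n"
  shows "B \<in> carrier_mat m n"
  using assms by (elim unimod_equivE) auto

lemma unimod_equiv_mult_left:
  assumes "A \<in> carrier_mat m n" "U \<in> carrier_mat m m" "unimodular U"
  shows "unimod_equiv A (U * A)"
  by (rule unimod_equivI[of A m n U "1\<^sub>m n"]) (use assms unimodular_one in auto)

lemma unimod_equiv_mult_right: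
  assumes "A \<in> carrier_mat m n" "V \<in> carrier_mat n n" "unimodular V"
  shows "unimod_equiv A (A * V)"
  by (rule unimod_equivI[of A m n "1\<^sub>m m" V]) (use assms unimodular_one in auto)

lemma unimod_equiv_refl: "unimod_equiv A A"
  using unimod_equiv_mult_left[of A "dim_row A" "dim_col A" "1\<^sub>m (dim_row A)"] unimodular_one by auto

lemma unimod_equiv_trans:
  assumes "unimod_equiv A B" "unimod_equiv B C"
  shows "unimod_equiv A C"
proof -
  define m n where "m = dim_row A" and "n = dim_col A"
  have A: "A \<in> carrier_mat m n" unfolding m_def n_def by simp
  obtain U V where U: "U \<in> carrier_mat m m" "V \<in> carrier_mat n n"
    "unimodular U" "unimodular V" "B = U * A * V" using unimod_equivE[OF assms(1) A] .
  obtain U' V' where U': "U' \<in> carrier_mat m m" "V' \<in> carrier_mat n n"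
    "unimodular U'" "unimodular V'" "C = U' * B * V'"
    using unimod_equivE[OF assms(2) unimod_equiv_carrier[OF assms(1) A]] .
  have "C = (U' * U) * A * (V * V')"
    unfolding U'(5) U(5) using A U(1,2) U'(1,2)
    by (simp add: assoc_mult_mat[of _ m m _ n _ n] assoc_mult_mat[of _ m m _ m _ n]
        assoc_mult_mat[of _ m n _ n _ n])
  then show ?thesis
    using unimod_equivI[OF A, of "U' * U" "V * V'" C] U U' unimodular_mult[of U' m U]
      unimodular_mult[of V n V'] by auto
qed

lemma unimod_equiv_sym:
  assumes "unimod_equiv A B"
  shows "unimod_equiv B A"
proof -
  define m n where "m = dim_row A" and "n = dim_col A"
  have A: "A \<in> carrier_mat m n" unfolding m_def n_def by simp
  obtain U V where U: "U \<in> carrier_mat m m" "V \<in> carrier_mat n n"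
    "unimodular U" "unimodular V" "B = U * A * V" using unimod_equivE[OF assms(1) A] .
  obtain U' where U': "U' \<in> carrier_mat m m" "U' * U = 1\<^sub>m m" "U * U' = 1\<^sub>m m" "unimodular U'"
    using unimodular_inverse[OF U(1,3)] .
  obtain V' where V': "V' \<in> carrier_mat n n" "V' * V = 1\<^sub>m n" "V * V' = 1\<^sub>m n" "unimodular V'"
    using unimodular_inverse[OF U(2,4)] .
  have "U' * B * V' = (U' * U) * A * (V * V')"
    unfolding U(5) using A U(1,2) U'(1) V'(1)
    by (simp add: assoc_mult_mat[of _ m m _ n _ n] assoc_mult_mat[of _ m m _ m _ n]
        assoc_mult_mat[of _ m n _ n _ n])
  also have "\<dots> = A" unfolding U' V' using A by simp
  finally show ?thesis 
    using unimod_equivI[OF unimod_equiv_carrier[OF assms A] U'(1) V'(1) U'(4) V'(4)] by simp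
qed

section \<open>Elementary row and column operations\<close>

lemma unimodular_swaprows_mat:
  assumes "k < n" "l < n"
  shows "unimodular (swaprows_mat n k l :: 'a::field poly mat)"
proof (cases "k = l")
  case True
  then have "swaprows_mat n k l = (1\<^sub>m n :: 'a poly mat)" using assms by (intro eq_matI) auto
  then show ?thesis by (simp add: unimodular_one)
next
  case False
  then show ?thesis using det_swaprows_mat[OF assms False, where 'a = "'a poly"] by (simp add: unimodular_def)
qed

lemma unimodular_addrow_mat:
  "k \<noteq> l \<Longrightarrow> unimodular (addrow_mat n (a :: 'a::field poly) k l)"
  using det_addrow_mat[of k l n a] by (simp add: unimodular_def)

lemma unimod_equiv_swaprows:
  "A \<in> carrier_mat m n \<Longrightarrow> k < m \<Longrightarrow> l < m \<Longrightarrow> unimod_equiv A (swaprows k l A)"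
  by (simp add: swaprows_mat[of A m n] unimod_equiv_mult_left unimodular_swaprows_mat)

lemma unimod_equiv_swapcols:
  "A \<in> carrier_mat m n \<Longrightarrow> k < n \<Longrightarrow> l < n \<Longrightarrow> unimod_equiv A (swapcols k l A)"
  by (simp add: swapcols_mat[of A m n] unimod_equiv_mult_right unimodular_swaprows_mat)

lemma unimod_equiv_addrow:
  "A \<in> carrier_mat m n \<Longrightarrow> k \<noteq> l \<Longrightarrow> l < m \<Longrightarrow> unimod_equiv A (addrow a k l A)"
  by (simp add: addrow_mat[of A m n] unimod_equiv_mult_left unimodular_addrow_mat)

lemma unimod_equiv_addcol:
  "A \<in> carrier_mat m n \<Longrightarrow> k \<noteq> l \<Longrightarrow> l < n \<Longrightarrow> unimod_equiv A (addcol a k l A)"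
  by (simp add: addcol_mat[of A m n] unimod_equiv_mult_right unimodular_addrow_mat)

text \<open>Through this, a minimality assumption about corner entries becomes one about all entries
  of equivalent matrices.\<close>

lemma unimod_equiv_move_to_corner:
  assumes "A \<in> carrier_mat m n" "i < m" "j < n"
  shows "\<exists>B. unimod_equiv A B \<and> B $$ (0,0) = A $$ (i,j)"
proof (intro exI conjI)
  let ?B = "swapcols 0 j (swaprows 0 i A)"
  show "unimod_equiv A ?B"
    using unimod_equiv_trans[OF unimod_equiv_swaprows unimod_equiv_swapcols] assms
    by (metis gr_zeroI not_less0 swaprows_carrier)
  show "?B $$ (0,0) = A $$ (i,j)" using assms by auto
qed

text \<open>Common divisors of all entries survive multiplication from either side; this carries the
  divisibility by the corner over to the Smith form of the remaining block.\<close>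

lemma dvd_mult_mat:
  fixes A B :: "'b::comm_ring_1 mat"
  assumes "A \<in> carrier_mat m k" "B \<in> carrier_mat k n" "i < m" "j < n"
    and "(\<forall>i<m. \<forall>j<k. b dvd A $$ (i,j)) \<or> (\<forall>i<k. \<forall>j<n. b dvd B $$ (i,j))"
  shows "b dvd (A * B) $$ (i,j)"
  using assms by (auto simp: scalar_prod_def intro!: dvd_sum)

lemma smith_diag_carrier [simp]: "smith_diag m n es \<in> carrier_mat m n"
  by (simp add: smith_diag_def)

lemma smith_diag_Cons:
  "smith_diag (Suc m) (Suc n) (e # es) =
     four_block_mat (mat 1 1 (\<lambda>_. e)) (0\<^sub>m 1 n) (0\<^sub>m m 1) (smith_diag m n es)"
  by (rule eq_matI) (auto simp: smith_diag_def less_Suc_eq_0_disj)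

text \<open>After moving an entry of minimal degree to the corner, the corner divides its row and its
  column in every equivalent matrix with the same corner, since a remainder would have smaller
  degree.\<close>
lemma minimal_corner_dvd:
  assumes C: "C \<in> carrier_mat m n"
    and min: "\<And>B. unimod_equiv C B \<Longrightarrow> B $$ (0,0) \<noteq> 0 \<Longrightarrow> degree (C $$ (0,0)) \<le> degree (B $$ (0,0))"
    and nz: "C $$ (0,0) \<noteq> 0"
  shows "0 < m \<Longrightarrow> j < n \<Longrightarrow> C $$ (0,0) dvd C $$ (0,j)"
    and "0 < n \<Longrightarrow> i < m \<Longrightarrow> C $$ (0,0) dvd C $$ (i,0)"
proof -
  \<comment> \<open>Any entry can be moved to the corner, so minimality bounds the degree of every
    nonzero entry of every equivalent matrix.\<close>
  have min': "D $$ (i,j) = 0 \<or> degree (C $$ (0,0)) \<le> degree (D $$ (i,j))"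
    if "unimod_equiv C D" "i < m" "j < n" for D i j
    using unimod_equiv_move_to_corner[OF unimod_equiv_carrier[OF that(1) C] that(2,3)] min
      unimod_equiv_trans[OF that(1)] by metis
  {
    assume "0 < m" "j < n"
    show "C $$ (0,0) dvd C $$ (0,j)"
    proof (cases "j = 0")
      case False
      \<comment> \<open>This column operation replaces the entry by its remainder modulo the corner,
        whose degree is too small unless it is zero.\<close>
      define D where "D = addcol (- (C $$ (0,j) div C $$ (0,0))) j 0 C"
      have "D $$ (0,j) = C $$ (0,j) - C $$ (0,j) div C $$ (0,0) * C $$ (0,0)"
        using C \<open>0 < m\<close> \<open>j < n\<close> by (simp add: D_def)
      then have D: "D $$ (0,j) = C $$ (0,j) mod C $$ (0,0)" by (simp add: minus_div_mult_eq_mod)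
      have "unimod_equiv C D" unfolding D_def
        using unimod_equiv_addcol[OF C False] \<open>j < n\<close> by auto
      from min'[OF this \<open>0 < m\<close> \<open>j < n\<close>] show ?thesis
        unfolding D using degree_mod_less[OF nz, of "C $$ (0,j)"] by auto
    qed simp
  }
  {
    assume "0 < n" "i < m"
    show "C $$ (0,0) dvd C $$ (i,0)"
    proof (cases "i = 0")
      case False
      define D where "D = addrow (- (C $$ (i,0) div C $$ (0,0))) i 0 C"
      have "D $$ (i,0) = C $$ (i,0) - C $$ (i,0) div C $$ (0,0) * C $$ (0,0)"
        using C \<open>0 < n\<close> \<open>i < m\<close> by (simp add: D_def)
      then have D: "D $$ (i,0) = C $$ (i,0) mod C $$ (0,0)" by (simp add: minus_div_mult_eq_mod)
      have "unimod_equiv C D" unfolding D_def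
        using unimod_equiv_addrow[OF C False] \<open>i < m\<close> by auto
      from min'[OF this \<open>i < m\<close> \<open>0 < n\<close>] show ?thesis
        unfolding D using degree_mod_less[OF nz, of "C $$ (i,0)"] by auto
    qed simp
  }
qed

text \<open>Take a nonzero corner of least degree in the whole equivalence class. It divides its row
  and column, which can therefore be cleared, and it divides the remaining block because each row of
  that block can be added to the first row.\<close>

lemma unimod_equiv_corner_block:
  fixes A :: "'a::field poly mat"
  assumes A: "A \<in> carrier_mat (Suc m) (Suc n)" and "A \<noteq> 0\<^sub>m (Suc m) (Suc n)"
  obtains b C where "b \<noteq> 0" "C \<in> carrier_mat m n"
    "unimod_equiv A (four_block_mat (mat 1 1 (\<lambda>_. b)) (0\<^sub>m 1 n) (0\<^sub>m m 1) C)"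
    "\<And>i j. i < m \<Longrightarrow> j < n \<Longrightarrow> b dvd C $$ (i,j)"
proof -
  obtain i j where "i < Suc m" "j < Suc n" "A $$ (i,j) \<noteq> 0"
    using assms by (metis carrier_matD eq_matI index_zero_mat)
  then have "\<exists>B. unimod_equiv A B \<and> B $$ (0,0) \<noteq> 0"
    using unimod_equiv_move_to_corner[OF A, of i j] by auto
  then obtain B0 where "unimod_equiv A B0 \<and> B0 $$ (0,0) \<noteq> 0" ..
  from ex_has_least_nat[where P = "\<lambda>B. unimod_equiv A B \<and> B $$ (0,0) \<noteq> 0", OF this,
      of "\<lambda>B. degree (B $$ (0,0))"]
  obtain B where AB: "unimod_equiv A B" and nz: "B $$ (0,0) \<noteq> 0"
    and min: "\<And>B'. unimod_equiv A B' \<Longrightarrow> B' $$ (0,0) \<noteq> 0 \<Longrightarrow> degree (B $$ (0,0)) \<le> degree (B' $$ (0,0))"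
    by auto
  define b where "b = B $$ (0,0)"
  \<comment> \<open>Every member of the class with corner \<open>b\<close> is again minimal, so the
    divisibility is available for later transforms as well as for \<open>B\<close>.\<close>
  have corner: "b dvd D $$ (0,j)" "i < Suc m \<Longrightarrow> b dvd D $$ (i,0)"
    if "unimod_equiv A D" "D $$ (0,0) = b" "j < Suc n" for D i j
    using minimal_corner_dvd[OF unimod_equiv_carrier[OF that(1) A]] that nz min unimod_equiv_trans[OF that(1)]
    unfolding b_def by (metis zero_less_Suc)+
  have B: "B \<in> carrier_mat (Suc m) (Suc n)" using unimod_equiv_carrier[OF AB A] .
  define u where "u = mat 1 n (\<lambda>(i,j). B $$ (0, Suc j) div b)"
  define v where "v = mat m 1 (\<lambda>(i,j). B $$ (Suc i, 0) div b)"
  define C where "C = mat m n (\<lambda>(i,j). B $$ (Suc i, Suc j) - v $$ (i,0) * b * u $$ (0,j))"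
  define D where "D = four_block_mat (mat 1 1 (\<lambda>_. b)) (0\<^sub>m 1 n) (0\<^sub>m m 1) C"
  define M where "M = four_block_mat (1\<^sub>m 1) (0\<^sub>m 1 m) v (1\<^sub>m m)"
  define N where "N = four_block_mat (1\<^sub>m 1) u (0\<^sub>m n 1) (1\<^sub>m n)"
  have car: "u \<in> carrier_mat 1 n" "v \<in> carrier_mat m 1" "C \<in> carrier_mat m n"
    unfolding u_def v_def C_def by auto
  have D: "D \<in> carrier_mat (Suc m) (Suc n)" using car unfolding D_def by auto
  have u: "b * u $$ (0,j) = B $$ (0, Suc j)" if "j < n" for j
    using corner(1)[OF AB, of "Suc j"] that by (simp add: b_def u_def)
  have v: "v $$ (i,0) * b = B $$ (Suc i, 0)" if "i < m" for i
    using corner(2)[OF AB, of 0 "Suc i"] that by (simp add: b_def v_def)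
  have "M * D = four_block_mat (mat 1 1 (\<lambda>_. b)) (0\<^sub>m 1 n) (v * mat 1 1 (\<lambda>_. b)) C"
    unfolding M_def D_def using car
    by (subst mult_four_block_mat[where ?nr1.0 = 1 and ?n1.0 = 1 and ?n2.0 = m and ?nr2.0 = m]) auto
  also have "\<dots> * N = four_block_mat (mat 1 1 (\<lambda>_. b)) (mat 1 1 (\<lambda>_. b) * u)
      (v * mat 1 1 (\<lambda>_. b)) (v * mat 1 1 (\<lambda>_. b) * u + C)"
    unfolding N_def using car
    by (subst mult_four_block_mat[where ?nr1.0 = 1 and ?n1.0 = 1 and ?n2.0 = n and ?nr2.0 = m]) auto
  also have "\<dots> = B"
  proof (rule eq_matI)
    fix i j assume "i < dim_row B" "j < dim_col B"
    then have "i < Suc m" "j < Suc n" using B by auto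
    then show "four_block_mat (mat 1 1 (\<lambda>_. b)) (mat 1 1 (\<lambda>_. b) * u)
      (v * mat 1 1 (\<lambda>_. b)) (v * mat 1 1 (\<lambda>_. b) * u + C) $$ (i,j) = B $$ (i,j)"
      using car u v by (cases i; cases j) (auto simp: scalar_prod_def b_def C_def)
  qed (use B car in auto)
  finally have MDN: "B = M * D * N" by simp
  have M: "M \<in> carrier_mat (Suc m) (Suc m)" "unimodular M"
    using car det_four_block_mat_upper_right_zero[of "1\<^sub>m 1" 1 "0\<^sub>m 1 m" m v "1\<^sub>m m"]
    unfolding M_def by (auto simp: unimodular_def)
  have N: "N \<in> carrier_mat (Suc n) (Suc n)" "unimodular N"
    using car det_four_block_mat_lower_left_zero[of "1\<^sub>m 1" 1 u n "0\<^sub>m n 1" "1\<^sub>m n"]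
    unfolding N_def by (auto simp: unimodular_def)
  have "unimod_equiv D B"
    using unimod_equivI[OF D M(1) N(1) M(2) N(2) MDN] .
  then have AD: "unimod_equiv A D" using AB unimod_equiv_sym unimod_equiv_trans by blast
  have "b dvd C $$ (i,j)" if "i < m" "j < n" for i j
  proof -
    \<comment> \<open>The first column of \<open>D\<close> is zero below the corner, so adding a
      lower row to the first row keeps the corner \<open>b\<close> while bringing the entries of
      \<open>C\<close> into the first row.\<close>
    define E where "E = addrow 1 0 (Suc i) D"
    have "unimod_equiv D E" unfolding E_def using unimod_equiv_addrow[OF D] that by auto
    then have "unimod_equiv A E" using AD unimod_equiv_trans by blast
    moreover have "E $$ (0,0) = b" "E $$ (0, Suc j) = C $$ (i,j)"
      using D that car unfolding E_def D_def by auto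
    ultimately show ?thesis using corner(1)[of E "Suc j"] that by auto
  qed
  then show ?thesis using that[of b C] nz car AD unfolding D_def b_def by blast
qed

text \<open>Induction on the number of rows: split off a corner dividing the remaining block,
  diagonalise that block, and make the corner monic.\<close>

lemma smith_form_exists:
  fixes A :: "'a::field poly mat"
  assumes "A \<in> carrier_mat m n"
  shows "\<exists>es. length es \<le> min m n \<and> (\<forall>e\<in>set es. e \<noteq> 0 \<and> lead_coeff e = 1) \<and>
     (\<forall>i. Suc i < length es \<longrightarrow> es ! i dvd es ! Suc i) \<and> unimod_equiv A (smith_diag m n es)"
  using assms
proof (induction m arbitrary: n A)
  case 0
  then have "A = smith_diag 0 n []" by (intro eq_matI) (auto simp: smith_diag_def)
  then show ?case using unimod_equiv_refl by (intro exI[of _ "[]"]) auto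
next
  case (Suc m n' A)
  show ?case
  proof (cases "n' = 0 \<or> A = 0\<^sub>m (Suc m) n'")
    case True
    then have "A = smith_diag (Suc m) n' []"
      using Suc.prems by (intro eq_matI) (auto simp: smith_diag_def)
    then show ?thesis using unimod_equiv_refl by (intro exI[of _ "[]"]) auto
  next
    case False
    then obtain n where n': "n' = Suc n" by (cases n') auto
    obtain b C where b: "b \<noteq> 0" and C: "C \<in> carrier_mat m n"
      and AD: "unimod_equiv A (four_block_mat (mat 1 1 (\<lambda>_. b)) (0\<^sub>m 1 n) (0\<^sub>m m 1) C)"
      and dvd: "\<And>i j. i < m \<Longrightarrow> j < n \<Longrightarrow> b dvd C $$ (i,j)"
      using unimod_equiv_corner_block[of A m n] Suc.prems False unfolding n' by metis
    obtain es where es: "length es \<le> min m n" "\<forall>e\<in>set es. e \<noteq> 0 \<and> lead_coeff e = 1"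
      "\<forall>i. Suc i < length es \<longrightarrow> es ! i dvd es ! Suc i" "unimod_equiv C (smith_diag m n es)"
      using Suc.IH[OF C] by blast
    obtain U V where UV: "U \<in> carrier_mat m m" "V \<in> carrier_mat n n"
      "unimodular U" "unimodular V" "smith_diag m n es = U * C * V"
      using unimod_equivE[OF es(4) C] .
    \<comment> \<open>The first diagonal entry of the block is a combination of entries of
      \<open>C\<close>, all divisible by \<open>b\<close>; this extends the divisibility chain to
      the front.\<close>
    have bes: "b dvd es ! 0" if "es \<noteq> []"
    proof -
      have 1: "b dvd (U * C) $$ (i,j)" if "i < m" "j < n" for i j
        by (rule dvd_mult_mat[OF UV(1) C that]) (use dvd in auto)
      have "0 < m" "0 < n" using es(1) that by (cases es; auto)+
      then have "b dvd (U * C * V) $$ (0,0)"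
        by (intro dvd_mult_mat[OF mult_carrier_mat[OF UV(1) C] UV(2)]) (use 1 in auto)
      then show ?thesis using \<open>0 < m\<close> \<open>0 < n\<close> that unfolding UV(5)[symmetric]
        by (simp add: smith_diag_def)
    qed
    \<comment> \<open>Scaling by this constant makes the corner monic; the scaling is put into the
      left transformation \<open>U'\<close>.\<close>
    define c where "c = inverse (lead_coeff b)"
    have c: "c \<noteq> 0" using b by (simp add: c_def)
    define b' where "b' = [:c:] * b"
    have b': "b' \<noteq> 0" "lead_coeff b' = 1" using b by (auto simp: b'_def c_def)
    have b'es: "b' dvd es ! 0" if "es \<noteq> []"
      using bes[OF that] c by (simp add: b'_def smult_dvd)
    define D where "D = four_block_mat (mat 1 1 (\<lambda>_. b)) (0\<^sub>m 1 n) (0\<^sub>m m 1) C"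
    define U' where "U' = four_block_mat (mat 1 1 (\<lambda>_. [:c:])) (0\<^sub>m 1 m) (0\<^sub>m m 1) U"
    define V' where "V' = four_block_mat (mat 1 1 (\<lambda>_. [:1:])) (0\<^sub>m 1 n) (0\<^sub>m n 1) V"
    have D: "D \<in> carrier_mat (Suc m) (Suc n)" using C unfolding D_def by auto
    have 1: "mat 1 1 (\<lambda>_. [:c:]) * mat 1 1 (\<lambda>_. b) = mat 1 1 (\<lambda>_. b')"
      "mat 1 1 (\<lambda>_. b') * mat 1 1 (\<lambda>_. [:1:]) = mat 1 1 (\<lambda>_. b')"
      by (intro eq_matI; simp add: scalar_prod_def b'_def)+
    have "U' * D = four_block_mat (mat 1 1 (\<lambda>_. b')) (0\<^sub>m 1 n) (0\<^sub>m m 1) (U * C)"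
      unfolding U'_def D_def 1(1)[symmetric] using C UV
      by (subst mult_four_block_mat[where ?nr1.0 = 1 and ?n1.0 = 1 and ?n2.0 = m and ?nr2.0 = m]) auto
    also have "\<dots> * V' = four_block_mat (mat 1 1 (\<lambda>_. b')) (0\<^sub>m 1 n) (0\<^sub>m m 1) (U * C * V)"
      unfolding V'_def using C UV 1(2)
      by (subst mult_four_block_mat[where ?nr1.0 = 1 and ?n1.0 = 1 and ?n2.0 = n and ?nr2.0 = m])
        (auto simp del: One_nat_def)
    also have "\<dots> = smith_diag (Suc m) (Suc n) (b' # es)" unfolding smith_diag_Cons UV(5) ..
    finally have "smith_diag (Suc m) (Suc n) (b' # es) = U' * D * V'" by simp
    moreover have "unimodular U'" "unimodular V'" unfolding U'_def V'_def
      using unimodular_four_block_diag UV c by (blast, metis one_neq_zero unimodular_four_block_diag UV(2,4))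
    moreover have "U' \<in> carrier_mat (Suc m) (Suc m)" "V' \<in> carrier_mat (Suc n) (Suc n)"
      unfolding U'_def V'_def using UV by auto
    ultimately have "unimod_equiv D (smith_diag (Suc m) (Suc n) (b' # es))"
      using unimod_equivI[OF D] by metis
    then have "unimod_equiv A (smith_diag (Suc m) (Suc n) (b' # es))"
      using AD unimod_equiv_trans unfolding D_def by blast
    moreover have "\<forall>i. Suc i < length (b' # es) \<longrightarrow> (b' # es) ! i dvd (b' # es) ! Suc i"
    proof (intro allI impI)
      fix i assume i: "Suc i < length (b' # es)"
      show "(b' # es) ! i dvd (b' # es) ! Suc i"
      proof (cases i)
        case 0
        with i b'es show ?thesis by (cases es) auto
      next
        case (Suc k)
        with i es(3) show ?thesis by auto
      qed
    qed
    ultimately show ?thesis using es(1,2) b' unfolding n'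
      by (intro exI[of _ "b' # es"]) auto
  qed
qed

lemma invariant_polys_exists: "\<exists>es. invariant_polys P es"
proof -
  obtain es where es: "length es \<le> min (dim_row P) (dim_col P)" "\<forall>e\<in>set es. e \<noteq> 0 \<and> lead_coeff e = 1"
      "\<forall>i. Suc i < length es \<longrightarrow> es ! i dvd es ! Suc i" 
      "unimod_equiv P (smith_diag (dim_row P) (dim_col P) es)"
    using smith_form_exists[of P "dim_row P" "dim_col P"] by auto
  from unimod_equivE[OF unimod_equiv_sym[OF es(4)] smith_diag_carrier] 
  obtain U V where "U \<in> carrier_mat (dim_row P) (dim_row P)" "V \<in> carrier_mat (dim_col P) (dim_col P)"
    "unimodular U" "unimodular V" "P = U * smith_diag (dim_row P) (dim_col P) es * V" .
  with es show ?thesis unfolding invariant_polys_def by blast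
qed

section \<open>Consequences of the Smith form\<close>

lemma det_smith_diag: "det (smith_diag (length es) (length es) es) = prod_list es"
proof -
  have "det (smith_diag (length es) (length es) es) = prod_list (diag_mat (smith_diag (length es) (length es) es))"
    by (rule det_upper_triangular) (auto simp: smith_diag_def)
  also have "diag_mat (smith_diag (length es) (length es) es) = es"
    by (rule nth_equalityI) (auto simp: diag_mat_def smith_diag_def)
  finally show ?thesis .
qed

text \<open>Only the leading \<open>k\<close> by \<open>k\<close> block of the Smith form is
  nonzero. Cutting \<open>U\<close> down to its first \<open>k\<close> columns and \<open>V\<close>
  to its first \<open>k\<close> rows loses unimodularity but keeps a one-sided inverse.\<close>

lemma invariant_polys_factorization:
  assumes "invariant_polys P es" and P: "P \<in> carrier_mat m n" and k: "k = length es"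
  obtains A D B where "A \<in> carrier_mat m k" "D \<in> carrier_mat k k" "B \<in> carrier_mat k n"
    "P = A * D * B" "left_invertible A" "right_invertible B" "det D = prod_list es" "det D \<noteq> 0"
    "D = smith_diag k k es" "k \<le> min m n"
proof -
  obtain U V where UV: "U \<in> carrier_mat m m" "V \<in> carrier_mat n n" "unimodular U" "unimodular V"
    and P_eq: "P = U * smith_diag m n es * V" and k_le: "k \<le> m" "k \<le> n"
    and nz: "\<forall>e\<in>set es. e \<noteq> 0"
    using assms unfolding invariant_polys_def by auto
  \<comment> \<open>\<open>E l\<close> consists of the first \<open>k\<close> columns of the
    identity of size \<open>l\<close>; multiplying by it selects columns, and by its transpose,
    rows.\<close>
  define E where "E l = (mat l k (\<lambda>(i,j). if i = j then 1 else 0) :: 'a poly mat)" for l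
  define D where "D = smith_diag k k es"
  have car: "E l \<in> carrier_mat l k" "D \<in> carrier_mat k k" for l
    unfolding E_def D_def smith_diag_def by auto
  have tE: "transpose_mat (E l) * E l = 1\<^sub>m k" if "k \<le> l" for l
  proof (rule eq_matI)
    fix i j assume "i < dim_row (1\<^sub>m k :: 'a poly mat)" "j < dim_col (1\<^sub>m k :: 'a poly mat)"
    then have ij: "i < k" "j < k" by auto
    have "(transpose_mat (E l) * E l) $$ (i,j) = (\<Sum>q<l. (if q = i then 1 else 0) * (if q = j then 1 else 0))"
      using ij by (simp add: E_def scalar_prod_def atLeast0LessThan)
    also have "\<dots> = (\<Sum>q<l. if q = i then (if i = j then 1 else 0) else 0)"
      by (intro sum.cong) auto
    also have "\<dots> = (1\<^sub>m k :: 'a poly mat) $$ (i,j)" using ij that by simp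
    finally show "(transpose_mat (E l) * E l) $$ (i,j) = (1\<^sub>m k :: 'a poly mat) $$ (i,j)" .
  qed (auto simp: E_def)
  have ED: "E m * D = smith_diag m k es"
  proof (rule eq_matI)
    fix i j assume "i < dim_row (smith_diag m k es)" "j < dim_col (smith_diag m k es)"
    then have ij: "i < m" "j < k" by (auto simp: smith_diag_def)
    have "(E m * D) $$ (i,j) = (\<Sum>q<k. (if i = q then 1 else 0) * (if q = j \<and> q < length es then es ! q else 0))"
      using ij by (simp add: E_def D_def smith_diag_def scalar_prod_def atLeast0LessThan)
    also have "\<dots> = (\<Sum>q<k. if q = i then (if i = j \<and> i < length es then es ! i else 0) else 0)"
      by (intro sum.cong) auto
    also have "\<dots> = smith_diag m k es $$ (i,j)" using ij k by (simp add: smith_diag_def)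
    finally show "(E m * D) $$ (i,j) = smith_diag m k es $$ (i,j)" .
  qed (use car in \<open>auto simp: smith_diag_def\<close>)
  have S: "E m * D * transpose_mat (E n) = smith_diag m n es"
    unfolding ED
  proof (rule eq_matI)
    fix i j assume "i < dim_row (smith_diag m n es)" "j < dim_col (smith_diag m n es)"
    then have ij: "i < m" "j < n" by (auto simp: smith_diag_def)
    have "(smith_diag m k es * transpose_mat (E n)) $$ (i,j) =
        (\<Sum>q<k. (if i = q \<and> i < length es then es ! i else 0) * (if j = q then 1 else 0))"
      using ij by (simp add: E_def smith_diag_def scalar_prod_def atLeast0LessThan)
    also have "\<dots> = (\<Sum>q<k. if q = i then (if i = j \<and> i < length es then es ! i else 0) else 0)"
      by (intro sum.cong) auto
    also have "\<dots> = smith_diag m n es $$ (i,j)" using ij k by (simp add: smith_diag_def)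
    finally show "(smith_diag m k es * transpose_mat (E n)) $$ (i,j) = smith_diag m n es $$ (i,j)" .
  qed (use car in \<open>auto simp: smith_diag_def E_def\<close>)
  have lE: "left_invertible (E l)" if "k \<le> l" for l
    using tE[OF that] car(1)[of l] unfolding left_invertible_def carrier_matD[OF car(1)]
    by (intro bexI[of _ "transpose_mat (E l)"]) auto
  have detD: "det D = prod_list es" unfolding D_def k by (rule det_smith_diag)
  show ?thesis
  proof (rule that[of "U * E m" D "transpose_mat (E n) * V"])
    show "left_invertible (U * E m)"
      using left_invertible_mult[OF UV(1) car(1)] lE[OF k_le(1)] unimodular_left_right_invertible[OF UV(3)] by auto
    have "right_invertible (transpose_mat (E n))"
      using lE[OF k_le(2)] by (simp add: left_invertible_transpose[symmetric])
    then show "right_invertible (transpose_mat (E n) * V)"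
      using right_invertible_mult[of "transpose_mat (E n)" k n V n] UV car
        unimodular_left_right_invertible[OF UV(4)] by auto
    show "det D = prod_list es" by fact
    show "det D \<noteq> 0" unfolding detD using nz by (auto simp: prod_list_zero_iff)
    show "k \<le> min m n" using k_le by simp
    have tc: "transpose_mat (E n) \<in> carrier_mat k n" using car by simp
    show "P = U * E m * D * (transpose_mat (E n) * V)"
    proof -
      have ED': "E m * D \<in> carrier_mat m k" by (rule mult_carrier_mat[OF car])
      have EDE: "E m * D * transpose_mat (E n) \<in> carrier_mat m n" by (rule mult_carrier_mat[OF ED' tc])
      have "U * (E m * D * transpose_mat (E n)) * V = U * ((E m * D * transpose_mat (E n)) * V)"
        by (rule assoc_mult_mat[OF UV(1) EDE UV(2)])
      also have "(E m * D * transpose_mat (E n)) * V = E m * D * (transpose_mat (E n) * V)"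
        by (rule assoc_mult_mat[OF ED' tc UV(2)])
      also have "U * \<dots> = U * (E m * D) * (transpose_mat (E n) * V)"
        by (rule assoc_mult_mat[OF UV(1) ED' mult_carrier_mat[OF tc UV(2)], symmetric])
      also have "U * (E m * D) = U * E m * D"
        by (rule assoc_mult_mat[OF UV(1) car, symmetric])
      finally show ?thesis unfolding P_eq S[symmetric] .
    qed
    show "transpose_mat (E n) * V \<in> carrier_mat k n" by (rule mult_carrier_mat[OF tc UV(2)])
  qed (use UV car in \<open>auto simp: D_def\<close>)
qed

text \<open>Cancelling the outer factors of the Smith factorization writes the nonsingular
  \<open>D\<close> as a product \<open>(X * L) * (R * Y)\<close> with inner dimension
  \<open>r\<close>.\<close>

lemma invariant_polys_length_le:
  assumes "invariant_polys (L * R) es" "L \<in> carrier_mat m r" "R \<in> carrier_mat r n"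
  shows "length es \<le> r"
proof -
  let ?k = "length es"
  obtain A D B where A: "A \<in> carrier_mat m ?k" and D: "D \<in> carrier_mat ?k ?k"
    and B: "B \<in> carrier_mat ?k n" and eq: "L * R = A * D * B"
    and "left_invertible A" "right_invertible B" "det D \<noteq> 0"
    using invariant_polys_factorization[OF assms(1) mult_carrier_mat[OF assms(2,3)] refl] by metis
  then obtain X Y where X: "X \<in> carrier_mat ?k m" "X * A = 1\<^sub>m ?k"
    and Y: "Y \<in> carrier_mat n ?k" "B * Y = 1\<^sub>m ?k"
    unfolding left_invertible_def right_invertible_def by auto
  have "(X * L) * (R * Y) = X * (L * R) * Y"
    using assms(2,3) X(1) Y(1)
    by (simp add: assoc_mult_mat[of _ ?k m _ r _ ?k] assoc_mult_mat[of _ ?k m _ n _ ?k] 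
       assoc_mult_mat[of _ m r _ n _ ?k])
  also have "\<dots> = (X * A) * D * (B * Y)"
    unfolding eq using A B D X(1) Y(1)
    by (simp add: assoc_mult_mat[of _ ?k m _ n _ ?k] assoc_mult_mat[of _ m ?k _ n _ ?k]
        assoc_mult_mat[of _ m ?k _ ?k _ ?k] assoc_mult_mat[of _ ?k m _ ?k _ ?k]
        assoc_mult_mat[of _ ?k ?k _ n _ ?k] assoc_mult_mat[of _ m ?k _ ?k _ n])
  also have "\<dots> = D" using X Y D by simp
  finally show ?thesis
    using inner_dim_ge_of_mult_det_nonzero[of "X * L" ?k r "R * Y"] \<open>det D \<noteq> 0\<close> assms X Y by auto
qed

text \<open>\<open>X * P * Y\<close> factors through dimension \<open>length es\<close>. If its
  determinant is nonzero this bounds \<open>r\<close>; if moreover \<open>length es \<le> r\<close>,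
  all factors are square and \<open>det D\<close>, the product of the invariant polynomials, splits
  off.\<close>

lemma invariant_polys_det_mult:
  assumes "invariant_polys P es" and P: "P \<in> carrier_mat m n"
    and X: "X \<in> carrier_mat r m" and Y: "Y \<in> carrier_mat n r"
  shows "det (X * P * Y) \<noteq> 0 \<Longrightarrow> r \<le> length es"
    and "length es \<le> r \<Longrightarrow> e \<in> set es \<Longrightarrow> e dvd det (X * P * Y)"
proof -
  define k where "k = length es"
  obtain A D B where A: "A \<in> carrier_mat m k" and D: "D \<in> carrier_mat k k"
    and B: "B \<in> carrier_mat k n" and eq: "P = A * D * B" and det: "det D = prod_list es"
    using invariant_polys_factorization[OF assms(1) P k_def] by metis
  have *: "X * P * Y = (X * A) * (D * (B * Y))"
    unfolding eq using A B D X Y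
    by (simp add: assoc_mult_mat[of _ r m _ n _ r] assoc_mult_mat[of _ m k _ n _ r]
        assoc_mult_mat[of _ m k _ k _ r] assoc_mult_mat[of _ r m _ k _ r]
        assoc_mult_mat[of _ k k _ n _ r] assoc_mult_mat[of _ m k _ k _ n])
  show ge: "r \<le> length es" if "det (X * P * Y) \<noteq> 0"
    using inner_dim_ge_of_mult_det_nonzero[of "X * A" r k "D * (B * Y)"] that A B D X Y 
    unfolding * k_def by auto
  show "e dvd det (X * P * Y)" if "length es \<le> r" "e \<in> set es"
  proof (cases "det (X * P * Y) = 0")
    case False
    then have "k = r" using ge that unfolding k_def by auto
    then have "det (X * P * Y) = det (X * A) * (det D * det (B * Y))"
      unfolding * using A B D X Y
      by (simp add: det_mult[of "X * A" r "D * (B * Y)"] det_mult[of D r "B * Y"])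
    moreover have "e dvd det D" unfolding det using that(2) by (rule prod_list_dvd)
    ultimately show ?thesis by simp
  qed simp
qed

section \<open>Injective matrices over polynomials and over fields\<close>

lemma injective_mat_imp_dim_le:
  fixes B :: "'b::idom mat"
  assumes B: "B \<in> carrier_mat k r" and "injective_mat B"
  shows "r \<le> k"
proof (rule ccontr)
  assume "\<not> r \<le> k"
  define B' where "B' = mat r r (\<lambda>(i,j). if i < k then B $$ (i,j) else 0)"
  have B': "B' \<in> carrier_mat r r" by (simp add: B'_def)
  have "det B' = 0"
    using \<open>\<not> r \<le> k\<close> by (subst laplace_expansion_row[OF B', of k]) (simp_all add: B'_def)
  then obtain v where v: "v \<in> carrier_vec r" "v \<noteq> 0\<^sub>v r" "B' *\<^sub>v v = 0\<^sub>v r"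
    using det_0_iff_vec_prod_zero[OF B'] by auto
  have "B *\<^sub>v v = 0\<^sub>v k"
  proof (rule eq_vecI)
    fix i assume "i < dim_vec (0\<^sub>v k :: 'b vec)"
    then have "i < k" by simp
    then have "(B *\<^sub>v v) $ i = (B' *\<^sub>v v) $ i"
      using B B' \<open>\<not> r \<le> k\<close> v(1) by (auto simp: scalar_prod_def B'_def intro!: sum.cong)
    then show "(B *\<^sub>v v) $ i = 0\<^sub>v k $ i" using v \<open>i < k\<close> \<open>\<not> r \<le> k\<close> by simp
  qed (use B in auto)
  then show False using assms v unfolding injective_mat_def by auto
qed

text \<open>This extracts a left invertible factor spanning the same rational subspace. In the Smith
  factorization \<open>A * D * B\<close> the kernel of \<open>B\<close> lies in the kernel of
  \<open>L\<close>, so \<open>B\<close> is injective and hence square; then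
  \<open>T = D * B\<close>.\<close>

lemma injective_mat_factorization:
  fixes L :: "'a::field poly mat"
  assumes L: "L \<in> carrier_mat m r" and "injective_mat L"
  obtains A T where "A \<in> carrier_mat m r" "T \<in> carrier_mat r r" "L = A * T"
    "left_invertible A" "det T \<noteq> 0"
proof -
  obtain es where es: "invariant_polys L es" using invariant_polys_exists by blast
  define k where "k = length es"
  obtain A D B where A: "A \<in> carrier_mat m k" and D: "D \<in> carrier_mat k k"
    and B: "B \<in> carrier_mat k r" and eq: "L = A * D * B"
    and "left_invertible A" and rB: "right_invertible B" and detD: "det D \<noteq> 0" and "k \<le> r"
    using invariant_polys_factorization[OF es L k_def] by (metis min.boundedE)
  have "injective_mat B" unfolding injective_mat_def
  proof (intro ballI impI)
    fix v assume v: "v \<in> carrier_vec (dim_col B)" and 0: "B *\<^sub>v v = 0\<^sub>v (dim_row B)"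
    have "L *\<^sub>v v = (A * D) *\<^sub>v (B *\<^sub>v v)" unfolding eq using A D B v by (intro assoc_mult_mat_vec) auto
    also have "\<dots> = 0\<^sub>v m" unfolding 0 using A B mult_carrier_mat[OF A D] by (intro eq_vecI) (auto simp del: assoc_mult_mat_vec)
    finally show "v = 0\<^sub>v (dim_col B)" using assms v B unfolding injective_mat_def by auto
  qed
  from injective_mat_imp_dim_le[OF B this] \<open>k \<le> r\<close> have kr: "k = r" by simp
  obtain Y where "Y \<in> carrier_mat r r" "B * Y = 1\<^sub>m r"
    using rB B kr unfolding right_invertible_def by auto
  then have "det B \<noteq> 0" using det_mult[of B r Y] B kr by auto
  show ?thesis
  proof (rule that[of A "D * B"])
    show "L = A * (D * B)" unfolding eq using A B D kr by (intro assoc_mult_mat) auto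
    show "det (D * B) \<noteq> 0" using det_mult[of D r B] D B detD \<open>det B \<noteq> 0\<close> kr by auto
  qed (use A B D kr \<open>left_invertible A\<close> in auto)
qed

lemma field_square_inverse:
  fixes T :: "'b::field mat"
  assumes T: "T \<in> carrier_mat r r" and "det T \<noteq> 0"
  obtains T' where "T' \<in> carrier_mat r r" "T * T' = 1\<^sub>m r" "T' * T = 1\<^sub>m r"
proof -
  define T' where "T' = inverse (det T) \<cdot>\<^sub>m adj_mat T"
  note adj = adj_mat[OF T]
  have 1: "T' \<in> carrier_mat r r" unfolding T'_def using adj by auto
  have 2: "T * T' = 1\<^sub>m r" unfolding T'_def mult_smult_distrib[OF T adj(1)] adj(2)
    using assms by (intro eq_matI) auto
  show ?thesis using that[OF 1 2] mat_mult_left_right_inverse[OF T 1 2] by blast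
qed

text \<open>A constant matrix with trivial kernel is injective over the polynomials too; comparing a
  suitable coefficient in \<open>X * C = det T \<cdot> 1\<close> then gives the constant left inverse.\<close>
lemma injective_mat_imp_left_invertible:
  fixes C :: "'a::field mat"
  assumes C: "C \<in> carrier_mat m r" and inj: "injective_mat C"
  shows "left_invertible C"
proof -
  define L where "L = map_mat (\<lambda>a. [:a:]) C"
  have L: "L \<in> carrier_mat m r" unfolding L_def using C by simp
  have "injective_mat L" unfolding injective_mat_def
  proof (intro ballI impI)
    fix v assume "v \<in> carrier_vec (dim_col L)" and 0: "L *\<^sub>v v = 0\<^sub>v (dim_row L)"
    then have v: "v \<in> carrier_vec r" using L by simp
    \<comment> \<open>As \<open>L\<close> is constant, the coefficients of \<open>v\<close> of each
      fixed degree form a constant vector in the kernel of \<open>C\<close>.\<close>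
    have "coeff (v $ j) q = 0" if "j < r" for j q
    proof -
      define w where "w = vec r (\<lambda>j. coeff (v $ j) q)"
      have "C *\<^sub>v w = 0\<^sub>v m"
      proof (rule eq_vecI)
        fix i assume "i < dim_vec (0\<^sub>v m :: 'a vec)"
        then have i: "i < m" by simp
        have "(C *\<^sub>v w) $ i = coeff ((L *\<^sub>v v) $ i) q"
          using i C v by (simp add: scalar_prod_def L_def w_def coeff_sum)
        then show "(C *\<^sub>v w) $ i = 0\<^sub>v m $ i" unfolding 0 using i L by simp
      qed (use C in auto)
      then have "w = 0\<^sub>v r" using inj C unfolding injective_mat_def w_def by auto
      then have "w $ j = 0" using that by simp
      then show ?thesis using that by (simp add: w_def)
    qed
    then show "v = 0\<^sub>v (dim_col L)" using v L by (intro eq_vecI) (auto simp: poly_eq_iff)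
  qed
  then obtain A T where A: "A \<in> carrier_mat m r" and T: "T \<in> carrier_mat r r" and LAT: "L = A * T"
    and "left_invertible A" and det: "det T \<noteq> 0" 
    using injective_mat_factorization[OF L] by metis
  then obtain X where X: "X \<in> carrier_mat r m" "X * A = 1\<^sub>m r" unfolding left_invertible_def by auto
  note adj = adj_mat[OF T]
  \<comment> \<open>\<open>T\<close> is not known to be unimodular; its adjugate cancels it up to
    the factor \<open>det T\<close>.\<close>
  define Z where "Z = adj_mat T * X"
  have Z: "Z \<in> carrier_mat r m" using adj X unfolding Z_def by auto
  have "Z * L = adj_mat T * (X * A * T)"
    unfolding Z_def LAT using adj(1) X(1) A T 
    by (simp add: assoc_mult_mat[of _ r r _ m _ r] assoc_mult_mat[of _ r m _ r _ r])
  also have "\<dots> = det T \<cdot>\<^sub>m 1\<^sub>m r" unfolding X(2) using adj T by simp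
  finally have ZL: "Z * L = det T \<cdot>\<^sub>m 1\<^sub>m r" .
  define q where "q = degree (det T)"
  \<comment> \<open>Since \<open>L\<close> is constant, taking coefficients of degree
    \<open>q\<close> in the product \<open>Z * L\<close> affects \<open>Z\<close> alone; the
    division turns the leading coefficient of \<open>det T\<close> on the diagonal into 1.\<close>
  define X0 where "X0 = mat r m (\<lambda>(i,j). coeff (Z $$ (i,j)) q / lead_coeff (det T))"
  have "X0 * C = 1\<^sub>m r"
  proof (rule eq_matI)
    fix i j assume "i < dim_row (1\<^sub>m r :: 'a mat)" "j < dim_col (1\<^sub>m r :: 'a mat)"
    then have ij: "i < r" "j < r" by auto
    have "(X0 * C) $$ (i,j) = coeff ((Z * L) $$ (i,j)) q / lead_coeff (det T)"
      using ij C Z by (simp add: X0_def scalar_prod_def L_def coeff_sum sum_divide_distrib mult_ac)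
    also have "\<dots> = (1\<^sub>m r :: 'a mat) $$ (i,j)"
      unfolding ZL using ij det by (simp add: q_def)
    finally show "(X0 * C) $$ (i,j) = (1\<^sub>m r :: 'a mat) $$ (i,j)" .
  qed (use C in \<open>auto simp: X0_def\<close>)
  then show ?thesis unfolding left_invertible_def using C 
    by (intro bexI[of _ X0]) (auto simp: X0_def)
qed

section \<open>Rank and the number of invariant polynomials\<close>

lemma mult_mat_unit_vec:
  assumes "(A :: 'b::comm_semiring_1 mat) \<in> carrier_mat m k" "i < k"
  shows "A *\<^sub>v unit_vec k i = col A i"
  using assms by (intro eq_vecI) auto

text \<open>The right inverse of \<open>B\<close> shows that \<open>A * B\<close> and
  \<open>A\<close> have the same column space, and the left inverse of \<open>A\<close> makes its
  \<open>k\<close> columns independent.\<close>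

lemma rank_mult_left_right_invertible:
  fixes A B :: "'b::field mat"
  assumes A: "A \<in> carrier_mat m k" and B: "B \<in> carrier_mat k n"
    and "left_invertible A" "right_invertible B"
  shows "vec_space.rank m (A * B) = k"
proof -
  interpret vec_space "TYPE('b)" m .
  obtain Y where Y: "Y \<in> carrier_mat n k" "B * Y = 1\<^sub>m k"
    using assms(4) B unfolding right_invertible_def by auto
  have AB: "A * B \<in> carrier_mat m n" using A B by auto
  have "col_space (A * B) = col_space A"
    unfolding col_space_eq[OF A] col_space_eq[OF AB]
  proof (intro Collect_cong conj_cong iffI)
    fix y assume "\<exists>x\<in>carrier_vec (dim_col (A * B)). A * B *\<^sub>v x = y"
    then obtain x where x: "x \<in> carrier_vec n" "A * B *\<^sub>v x = y" using B by auto
    then have "A *\<^sub>v (B *\<^sub>v x) = y" using assoc_mult_mat_vec[OF A B x(1)] by simp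
    then show "\<exists>x\<in>carrier_vec (dim_col A). A *\<^sub>v x = y" using A B x by (intro bexI[of _ "B *\<^sub>v x"]) auto
  next
    fix y assume "\<exists>x\<in>carrier_vec (dim_col A). A *\<^sub>v x = y"
    then obtain x where x: "x \<in> carrier_vec k" "A *\<^sub>v x = y" using A by auto
    have "A * B *\<^sub>v (Y *\<^sub>v x) = A *\<^sub>v ((B * Y) *\<^sub>v x)"
      using assoc_mult_mat_vec[OF A B, of "Y *\<^sub>v x"] assoc_mult_mat_vec[OF B Y(1) x(1)] Y(1) x(1) by simp
    then have "A * B *\<^sub>v (Y *\<^sub>v x) = y" using Y x by simp
    then show "\<exists>x\<in>carrier_vec (dim_col (A * B)). A * B *\<^sub>v x = y"
      using Y x B by (intro bexI[of _ "Y *\<^sub>v x"]) auto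
  qed (use A B in auto)
  then have "rank (A * B) = rank A" unfolding rank_def col_space_def by simp
  also have "rank A = k"
  proof (rule lin_indpt_full_rank[OF A])
    have inj: "injective_mat A" using left_invertible_imp_injective assms by blast
    \<comment> \<open>\<open>lin_indpt\<close> speaks of the set of columns, so repeated columns
      have to be excluded separately.\<close>
    show dist: "distinct (cols A)" unfolding distinct_conv_nth
    proof (intro allI impI)
      fix i j assume ij: "i < length (cols A)" "j < length (cols A)" "i \<noteq> j"
      then have ij': "i < k" "j < k" using A by auto
      show "cols A ! i \<noteq> cols A ! j"
      proof
        assume "cols A ! i = cols A ! j"
        then have "col A i = col A j" using ij by simp
        then have "A *\<^sub>v (unit_vec k i - unit_vec k j) = 0\<^sub>v m"
          using A ij' by (simp add: mult_minus_distrib_mat_vec[of _ m k] mult_mat_unit_vec[of _ m k])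
        then have "unit_vec k i - unit_vec k j = (0\<^sub>v k :: 'b vec)"
          using inj A unfolding injective_mat_def by auto
        then have "(unit_vec k i - unit_vec k j :: 'b vec) $ i = 0" using ij' by simp
        then show False using ij' ij(3) by simp
      qed
    qed
    show "lin_indpt (set (cols A))"
    proof
      assume "lin_dep (set (cols A))"
      from lin_depE[OF A this dist] inj A show False unfolding injective_mat_def by auto
    qed
  qed
  finally show ?thesis .
qed

lemma frac_mat_carrier [simp]: "frac_mat A \<in> carrier_mat m n \<longleftrightarrow> A \<in> carrier_mat m n"
  by (simp add: frac_mat_def)

lemma frac_mat_mult:
  assumes "A \<in> carrier_mat m k" "B \<in> carrier_mat k n"
  shows "frac_mat (A * B) = frac_mat A * frac_mat B"
  unfolding frac_mat_def using to_fract_hom.mat_hom_mult[OF assms] .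

lemma frac_mat_left_invertible: "left_invertible A \<Longrightarrow> left_invertible (frac_mat A)"
  unfolding frac_mat_def by (rule comm_ring_hom.left_invertible_map_mat[OF to_fract_hom.comm_ring_hom_axioms])

lemma frac_mat_right_invertible: "right_invertible A \<Longrightarrow> right_invertible (frac_mat A)"
  unfolding frac_mat_def by (rule comm_ring_hom.right_invertible_map_mat[OF to_fract_hom.comm_ring_hom_axioms])

lemma det_frac_mat: "det (frac_mat A) = to_fract (det A)"
  unfolding frac_mat_def by (rule to_fract_hom.hom_det)

lemma normal_rank_mult:
  assumes "A \<in> carrier_mat m k" "B \<in> carrier_mat k n" "left_invertible A" "right_invertible B"
  shows "normal_rank (A * B) = k"
  using rank_mult_left_right_invertible[of "frac_mat A" m k "frac_mat B" n] assms
    frac_mat_left_invertible frac_mat_right_invertible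
  by (auto simp: normal_rank_def frac_mat_mult)

text \<open>Over the rational functions the nonsingular \<open>D\<close> of the Smith factorization
  becomes invertible and can be absorbed into the right factor.\<close>

lemma normal_rank_eq_length_invariant_polys:
  assumes "invariant_polys P es"
  shows "normal_rank P = length es"
proof -
  define m n k where "m = dim_row P" and "n = dim_col P" and "k = length es"
  have P: "P \<in> carrier_mat m n" by (simp add: m_def n_def)
  obtain A D B where A: "A \<in> carrier_mat m k" and D: "D \<in> carrier_mat k k"
    and B: "B \<in> carrier_mat k n" and eq: "P = A * D * B"
    and lA: "left_invertible A" and rB: "right_invertible B" and detD: "det D \<noteq> 0"
    using invariant_polys_factorization[OF assms P k_def] by metis
  have "det (frac_mat D) \<noteq> 0" using detD by (simp add: det_frac_mat)
  then have "right_invertible (frac_mat D)"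
    using field_square_inverse[of "frac_mat D" k] D unfolding right_invertible_def
    by (metis carrier_matD frac_mat_carrier)
  then have "right_invertible (frac_mat D * frac_mat B)"
    using D B rB by (intro right_invertible_mult) (auto intro: frac_mat_right_invertible)
  then have "vec_space.rank m (frac_mat A * (frac_mat D * frac_mat B)) = k"
    using A B D lA by (intro rank_mult_left_right_invertible[of _ m k _ n]) (auto intro: frac_mat_left_invertible)
  moreover have "frac_mat P = frac_mat A * (frac_mat D * frac_mat B)"
    unfolding eq using A B D 
    by (simp add: frac_mat_mult[of _ m k _ n] frac_mat_mult[of _ k k _ n] frac_mat_mult[of _ m k _ k] assoc_mult_mat[of _ m k _ k _ n])
  ultimately show ?thesis unfolding normal_rank_def k_def m_def by simp
qed

section \<open>Column reduced matrices and minimal bases\<close>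

lemma coeff_mult_degree_bounds:
  fixes p q :: "'a::comm_semiring_0 poly"
  assumes "degree p \<le> a" "degree q \<le> b"
  shows "coeff (p * q) (a + b) = coeff p a * coeff q b"
proof -
  have "coeff (p * q) (a + b) = (\<Sum>i\<le>a + b. if i = a then coeff p a * coeff q b else 0)"
    unfolding coeff_mult
  proof (intro sum.cong refl)
    fix i
    consider "i < a" | "i = a" | "a < i" by linarith
    then show "coeff p i * coeff q (a + b - i) = (if i = a then coeff p a * coeff q b else 0)"
      by cases (use assms in \<open>auto simp: coeff_eq_0\<close>)
  qed
  then show ?thesis by simp
qed

lemma finite_degree_set: "finite {degree (v $ i) | i. i < dim_vec v}"
  by (simp add: setcompr_eq_image)

lemma vec_deg_ge:
  assumes "i < dim_vec v" "v $ i \<noteq> 0"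
  shows "ereal (real (degree (v $ i))) \<le> vec_deg v"
proof -
  have "v \<noteq> 0\<^sub>v (dim_vec v)" using assms by (metis index_zero_vec(1))
  moreover have "degree (v $ i) \<le> Max {degree (v $ i) | i. i < dim_vec v}"
    using assms(1) by (intro Max_ge finite_degree_set) auto
  ultimately show ?thesis by (simp add: vec_deg_def)
qed

lemma vec_deg_eqI:
  assumes "\<And>i. i < dim_vec v \<Longrightarrow> degree (v $ i) \<le> d" "i < dim_vec v" "coeff (v $ i) d \<noteq> 0"
  shows "vec_deg v = ereal (real d)"
proof -
  have "degree (v $ i) = d" using assms le_degree[of "v $ i" d] by (intro antisym) auto
  then have "Max {degree (v $ i) | i. i < dim_vec v} = d"
    using assms by (intro Max_eqI finite_degree_set) auto
  moreover have "v \<noteq> 0\<^sub>v (dim_vec v)" using assms(2,3) by (metis coeff_0 index_zero_vec(1))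
  ultimately show ?thesis by (simp add: vec_deg_def)
qed

lemma vec_deg_nonzeroE:
  assumes "v \<noteq> 0\<^sub>v (dim_vec v)"
  obtains d i where "vec_deg v = ereal (real d)" "i < dim_vec v" "coeff (v $ i) d \<noteq> 0"
    "\<And>i. i < dim_vec v \<Longrightarrow> degree (v $ i) \<le> d"
proof -
  let ?S = "{i. i < dim_vec v \<and> v $ i \<noteq> 0}"
  have "?S \<noteq> {}" using assms by auto
  then have Max: "Max ((\<lambda>i. degree (v $ i)) ` ?S) \<in> (\<lambda>i. degree (v $ i)) ` ?S"
    by (intro Max_in) auto
  obtain i where i: "Max ((\<lambda>i. degree (v $ i)) ` ?S) = degree (v $ i)" "i \<in> ?S"
    by (rule imageE[OF Max])
  have le: "degree (v $ j) \<le> degree (v $ i)" if "j < dim_vec v" for j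
    unfolding i(1)[symmetric] using that by (cases "v $ j = 0") (auto intro!: Max_ge)
  have i': "i < dim_vec v" "lead_coeff (v $ i) \<noteq> 0" using i(2) by auto
  show ?thesis
    by (rule that[OF vec_deg_eqI[OF le i'] i' le])
qed

text \<open>When \<delta> gives the column degrees, this is the highest column degree coefficient
  matrix. Leaving \<delta> free allows work with mere degree bounds.\<close>

definition lead_mat :: "(nat \<Rightarrow> nat) \<Rightarrow> 'a::field poly mat \<Rightarrow> 'a mat" where
  "lead_mat \<delta> L = mat (dim_row L) (dim_col L) (\<lambda>(i,j). coeff (L $$ (i,j)) (\<delta> j))"

text \<open>Here \<delta> is only required to bound the column degrees; injectivity rules out zero
  columns of the leading matrix and so forces the bounds to be attained.\<close>

definition col_reduced :: "(nat \<Rightarrow> nat) \<Rightarrow> 'a::field poly mat \<Rightarrow> bool" where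
  "col_reduced \<delta> L \<longleftrightarrow>
     (\<forall>i<dim_row L. \<forall>j<dim_col L. degree (L $$ (i,j)) \<le> \<delta> j) \<and> injective_mat (lead_mat \<delta> L)"

lemma lead_mat_carrier [simp]: "L \<in> carrier_mat m r \<Longrightarrow> lead_mat \<delta> L \<in> carrier_mat m r"
  by (simp add: lead_mat_def)

lemma injective_mat_col_nonzero:
  fixes A :: "'b::comm_ring_1 mat"
  assumes A: "A \<in> carrier_mat m r" and "injective_mat A" and "j < r"
  shows "col A j \<noteq> 0\<^sub>v m"
proof
  assume "col A j = 0\<^sub>v m"
  then have "unit_vec r j = (0\<^sub>v r :: 'b vec)"
    using assms mult_mat_unit_vec[OF A \<open>j < r\<close>] unfolding injective_mat_def by auto
  then show False using assms(3) by simp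
qed

lemma col_reduced_vec_deg:
  assumes L: "L \<in> carrier_mat m r" and red: "col_reduced \<delta> L" and j: "j < r"
  shows "vec_deg (col L j) = ereal (real (\<delta> j))"
proof -
  have "col (lead_mat \<delta> L) j \<noteq> 0\<^sub>v m"
    using injective_mat_col_nonzero[OF lead_mat_carrier[OF L] _ j] red unfolding col_reduced_def by auto
  then obtain i where "i < m" "col (lead_mat \<delta> L) j $ i \<noteq> 0"
    using L by (metis carrier_matD(1) dim_col eq_vecI index_zero_vec lead_mat_carrier)
  then show ?thesis using red L j
    by (intro vec_deg_eqI[of _ _ i]) (auto simp: lead_mat_def col_reduced_def)
qed

text \<open>Let \<open>N\<close> be the largest \<delta> j + deg (t j) over the nonzero entries of
  \<open>t\<close>. The coefficient of \<open>L t\<close> at \<open>N\<close> is the leading matrix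
  applied to a nonzero vector, so no cancellation in all rows is possible.\<close>

lemma predictable_degree:
  assumes L: "L \<in> carrier_mat m r" and red: "col_reduced \<delta> L"
    and t: "t \<in> carrier_vec r" and j: "j < r" "t $ j \<noteq> 0"
  shows "\<exists>i<m. (L *\<^sub>v t) $ i \<noteq> 0 \<and> \<delta> j + degree (t $ j) \<le> degree ((L *\<^sub>v t) $ i)"
proof -
  let ?S = "{j. j < r \<and> t $ j \<noteq> 0}"
  define N where "N = Max ((\<lambda>j. \<delta> j + degree (t $ j)) ` ?S)"
  have N: "\<delta> j + degree (t $ j) \<le> N" if "j \<in> ?S" for j
    unfolding N_def using that by (intro Max_ge) auto
  have "N \<in> (\<lambda>j. \<delta> j + degree (t $ j)) ` ?S"
    unfolding N_def using j by (intro Max_in) auto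
  then obtain k where k: "k < r" "t $ k \<noteq> 0" "N = \<delta> k + degree (t $ k)" by auto
  \<comment> \<open>Entry \<open>j\<close> is the leading coefficient of \<open>t $ j\<close> if
    this index attains the maximum \<open>N\<close>, and zero otherwise.\<close>
  define c where "c = vec r (\<lambda>j. if t $ j = 0 then 0 else coeff (t $ j) (N - \<delta> j))"
  have coeff: "coeff ((L *\<^sub>v t) $ i) N = (lead_mat \<delta> L *\<^sub>v c) $ i" if "i < m" for i
  proof -
    have "coeff (L $$ (i,j) * t $ j) N = coeff (L $$ (i,j)) (\<delta> j) * c $ j" if "j < r" for j
    proof (cases "t $ j = 0")
      case False
      then have "\<delta> j + degree (t $ j) \<le> N" using N that by auto
      then have "coeff (L $$ (i,j) * t $ j) (\<delta> j + (N - \<delta> j)) 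
          = coeff (L $$ (i,j)) (\<delta> j) * coeff (t $ j) (N - \<delta> j)"
        using red L \<open>i < m\<close> \<open>j < r\<close> by (intro coeff_mult_degree_bounds) (auto simp: col_reduced_def)
      then show ?thesis using \<open>\<delta> j + degree (t $ j) \<le> N\<close> False that by (simp add: c_def)
    qed (use that in \<open>simp add: c_def\<close>)
    then show ?thesis
      using that L t by (simp add: scalar_prod_def coeff_sum lead_mat_def c_def)
  qed
  have "c $ k \<noteq> 0" using k by (simp add: c_def)
  then have "c \<noteq> 0\<^sub>v r" using k(1) by auto
  moreover have "c \<in> carrier_vec r" by (simp add: c_def)
  ultimately have "lead_mat \<delta> L *\<^sub>v c \<noteq> 0\<^sub>v m"
    using red L lead_mat_carrier[OF L, of \<delta>] unfolding col_reduced_def injective_mat_def by auto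
  then obtain i where i: "i < m" "(lead_mat \<delta> L *\<^sub>v c) $ i \<noteq> 0"
    using lead_mat_carrier[OF L, of \<delta>]
    by (metis carrier_matD(1) dim_mult_mat_vec eq_vecI index_zero_vec)
  then have nz: "coeff ((L *\<^sub>v t) $ i) N \<noteq> 0" using coeff by simp
  have "\<delta> j + degree (t $ j) \<le> N" using N j by auto
  also have "N \<le> degree ((L *\<^sub>v t) $ i)" using nz by (rule le_degree)
  finally show ?thesis using nz i by (metis coeff_0)
qed

section \<open>Independence, span and minimal bases in terms of matrices\<close>

lemma lin_indep_list_cols:
  assumes A: "A \<in> carrier_mat m r"
  shows "lin_indep_list m (cols A) \<longleftrightarrow> injective_mat A"
proof -
  have eq: "(\<Sum>i<length (cols A). c i * (cols A ! i) $ j) = (A *\<^sub>v vec r c) $ j" if "j < m" for c j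
    using A that by (simp add: scalar_prod_def atLeast0LessThan mult.commute)
  show ?thesis
  proof
    assume indep: "lin_indep_list m (cols A)"
    show "injective_mat A" unfolding injective_mat_def
    proof (intro ballI impI)
      fix v assume v: "v \<in> carrier_vec (dim_col A)" and 0: "A *\<^sub>v v = 0\<^sub>v (dim_row A)"
      have "vec r (($) v) = v" using v A by auto
      then have "\<forall>j<m. (\<Sum>i<length (cols A). v $ i * (cols A ! i) $ j) = 0"
        using eq[of _ "($) v"] 0 A by simp
      then have "\<forall>i<length (cols A). v $ i = 0" using indep unfolding lin_indep_list_def by blast
      then show "v = 0\<^sub>v (dim_col A)" using v by auto
    qed
  next
    assume inj: "injective_mat A"
    show "lin_indep_list m (cols A)" unfolding lin_indep_list_def
    proof (intro allI impI)
      fix c i assume 0: "\<forall>j<m. (\<Sum>i<length (cols A). c i * (cols A ! i) $ j) = 0"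
        and i: "i < length (cols A)"
      have "A *\<^sub>v vec r c = 0\<^sub>v m"
        using 0 eq[of _ c] A by (intro eq_vecI) auto
      then have "vec r c = 0\<^sub>v r" using inj A unfolding injective_mat_def by auto
      then have "vec r c $ i = 0" using i A by simp
      then show "c i = 0" using i A by simp
    qed
  qed
qed

lemma span_list_cols:
  assumes A: "A \<in> carrier_mat m r"
  shows "span_list m (cols A) = {A *\<^sub>v v | v. v \<in> carrier_vec r}"
proof -
  have eq: "vec m (\<lambda>j. \<Sum>i<length (cols A). c i * (cols A ! i) $ j) = A *\<^sub>v vec r c" for c
    using A by (intro eq_vecI) (simp_all add: scalar_prod_def atLeast0LessThan mult.commute)
  have "{A *\<^sub>v vec r c | c. True} = {A *\<^sub>v v | v. v \<in> carrier_vec r}"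
  proof (intro equalityI subsetI)
    fix x assume "x \<in> {A *\<^sub>v v | v. v \<in> carrier_vec r}"
    then obtain v where v: "v \<in> carrier_vec r" "x = A *\<^sub>v v" by auto
    have "vec r (($) v) = v" using v(1) by auto
    then have "x = A *\<^sub>v vec r (($) v)" using v(2) by simp
    then show "x \<in> {A *\<^sub>v vec r c | c. True}" by blast
  qed auto
  then show ?thesis unfolding span_list_def eq .
qed

lemma span_list_cols_subset_imp_mult:
  assumes A: "A \<in> carrier_mat m r" and W: "W \<in> carrier_mat m q"
    and sub: "span_list m (cols W) \<subseteq> span_list m (cols A)"
  obtains T where "T \<in> carrier_mat r q" "W = A * T"
proof -
  have "\<exists>v. v \<in> carrier_vec r \<and> col W j = A *\<^sub>v v" if "j < q" for j
  proof -
    have "col W j = W *\<^sub>v unit_vec q j" using mult_mat_unit_vec[OF W that] by simp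
    then have "col W j \<in> span_list m (cols W)" unfolding span_list_cols[OF W] by auto
    then show ?thesis using sub unfolding span_list_cols[OF A] by auto
  qed
  then obtain v where v: "\<And>j. j < q \<Longrightarrow> v j \<in> carrier_vec r" "\<And>j. j < q \<Longrightarrow> col W j = A *\<^sub>v v j"
    by metis
  define T where "T = mat r q (\<lambda>(i,j). v j $ i)"
  have T: "T \<in> carrier_mat r q" by (simp add: T_def)
  have "col T j = v j" if "j < q" for j
    using v(1)[OF that] that by (intro eq_vecI) (auto simp: T_def)
  then have "W = A * T"
    using A W T v(2) by (intro mat_col_eqI) (auto simp: col_mult2[OF A T])
  with T show ?thesis using that by blast
qed

lemma span_list_cols_mult_subset:
  assumes A: "A \<in> carrier_mat m r" and T: "T \<in> carrier_mat r q"
  shows "span_list m (cols (A * T)) \<subseteq> span_list m (cols A)"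
proof -
  have AT: "A * T \<in> carrier_mat m q" using A T by simp
  show ?thesis unfolding span_list_cols[OF A] span_list_cols[OF AT]
    using assoc_mult_mat_vec[OF A T] T by auto
qed

lemma map_frac_vec_cols: "map frac_vec (cols L) = cols (frac_mat L)"
  by (intro nth_equalityI) (auto simp: frac_vec_def frac_mat_def)

lemma injective_frac_mat_imp_injective:
  assumes "injective_mat (frac_mat L)"
  shows "injective_mat L"
  unfolding injective_mat_def
proof (intro ballI impI)
  fix v assume v: "v \<in> carrier_vec (dim_col L)" and 0: "L *\<^sub>v v = 0\<^sub>v (dim_row L)"
  have "frac_mat L *\<^sub>v map_vec to_fract v = map_vec to_fract (L *\<^sub>v v)"
    unfolding frac_mat_def using v by (intro to_fract_hom.mult_mat_vec_hom[symmetric]) auto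
  also have "\<dots> = 0\<^sub>v (dim_row L)" unfolding 0 by (rule to_fract_hom.vec_hom_zero)
  finally have "map_vec to_fract v = 0\<^sub>v (dim_col L)"
    using assms v unfolding injective_mat_def frac_mat_def by auto
  then show "v = 0\<^sub>v (dim_col L)" 
    using v by (auto simp: vec_eq_iff)
qed

text \<open>Competing bases become matrices. Their number of columns \<open>q\<close> is left open,
  as in the definition by lists; that it equals \<open>r\<close> is derived from the equality of
  spans when needed.\<close>

lemma minimal_basis_cols_iff:
  fixes L :: "'a::field poly mat"
  assumes L: "L \<in> carrier_mat m r"
  shows "minimal_basis m (cols L) \<longleftrightarrow> injective_mat (frac_mat L) \<and>
    (\<forall>q. \<forall>W \<in> carrier_mat m q. injective_mat (frac_mat W) \<and>
       span_list m (cols (frac_mat W)) = span_list m (cols (frac_mat L)) \<longrightarrow>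
       (\<Sum>j<r. vec_deg (col L j)) \<le> (\<Sum>j<q. vec_deg (col W j)))" (is "?l \<longleftrightarrow> ?r")
proof -
  have sum: "sum_list (map vec_deg (cols W)) = (\<Sum>j<q. vec_deg (col W j))"
    if "W \<in> carrier_mat m q" for q and W :: "'a poly mat"
    using that by (simp add: sum_list_sum_nth atLeast0LessThan)
  have indep: "lin_indep_list m (map frac_vec (cols W)) \<longleftrightarrow> injective_mat (frac_mat W)"
    if "W \<in> carrier_mat m q" for q and W :: "'a poly mat"
    using that lin_indep_list_cols[of "frac_mat W" m q] by (simp add: map_frac_vec_cols)
  have cols: "set (cols W) \<subseteq> carrier_vec m" if "W \<in> carrier_mat m q" for q and W :: "'a poly mat"
    using cols_dim[of W] that by simp
  show ?thesis
  proof
    assume ?l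
    then have "injective_mat (frac_mat L)" unfolding minimal_basis_def using indep[OF L] by simp
    moreover have "(\<Sum>j<r. vec_deg (col L j)) \<le> (\<Sum>j<q. vec_deg (col W j))"
      if W: "W \<in> carrier_mat m q" and "injective_mat (frac_mat W)"
       "span_list m (cols (frac_mat W)) = span_list m (cols (frac_mat L))" for q W
    proof -
      have "sum_list (map vec_deg (cols L)) \<le> sum_list (map vec_deg (cols W))"
        using \<open>?l\<close> that(2,3) cols[OF W] indep[OF W] unfolding minimal_basis_def
        by (simp add: map_frac_vec_cols)
      then show ?thesis unfolding sum[OF W] sum[OF L] .
    qed
    ultimately show ?r by blast
  next
    assume r: ?r
    show ?l unfolding minimal_basis_def
    proof (intro conjI allI impI)
      fix ws :: "'a poly vec list"
      assume ws: "set ws \<subseteq> carrier_vec m \<and> lin_indep_list m (map frac_vec ws) \<and>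
        span_list m (map frac_vec ws) = span_list m (map frac_vec (cols L))"
      define W where "W = mat_of_cols m ws"
      have W: "W \<in> carrier_mat m (length ws)" and cW: "cols W = ws"
        using ws by (auto simp: W_def)
      have "injective_mat (frac_mat W)" using indep[OF W] ws by (simp add: cW)
      moreover have "span_list m (cols (frac_mat W)) = span_list m (cols (frac_mat L))"
        using ws by (simp add: map_frac_vec_cols[symmetric] cW)
      ultimately have "(\<Sum>j<r. vec_deg (col L j)) \<le> (\<Sum>j<length ws. vec_deg (col W j))"
        using r W by blast
      then have "sum_list (map vec_deg (cols L)) \<le> sum_list (map vec_deg (cols W))"
        unfolding sum[OF W] sum[OF L] .
      then show "sum_list (map vec_deg (cols L)) \<le> sum_list (map vec_deg ws)" unfolding cW .
    next
      show "set (cols L) \<subseteq> carrier_vec m" by (rule cols[OF L])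
      show "lin_indep_list m (map frac_vec (cols L))" unfolding indep[OF L] using r by blast
    qed
  qed
qed

text \<open>The left inverse makes the transition matrix to any competing polynomial basis
  \<open>W\<close> polynomial. Each column of \<open>L\<close> then occurs in a suitable column of
  \<open>W\<close>, which by predictable degrees has at least the same degree, and a permutation
  makes this assignment bijective.\<close>

lemma minimal_basis_if_col_reduced:
  fixes L :: "'a::field poly mat"
  assumes L: "L \<in> carrier_mat m r" and left: "left_invertible L" and red: "col_reduced \<delta> L"
  shows "minimal_basis m (cols L)"
  unfolding minimal_basis_cols_iff[OF L]
proof (intro conjI allI ballI impI)
  note injL = left_invertible_imp_injective[OF frac_mat_left_invertible[OF left]]
  show "injective_mat (frac_mat L)" by (rule injL)
  obtain X where X: "X \<in> carrier_mat r m" "X * L = 1\<^sub>m r"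
    using left L unfolding left_invertible_def by auto
  fix q and W :: "'a poly mat"
  assume W: "W \<in> carrier_mat m q"
    and "injective_mat (frac_mat W) \<and> span_list m (cols (frac_mat W)) = span_list m (cols (frac_mat L))"
  then have injW: "injective_mat (frac_mat W)"
    and span: "span_list m (cols (frac_mat W)) = span_list m (cols (frac_mat L))" by auto
  let ?L = "frac_mat L" and ?W = "frac_mat W" and ?X = "frac_mat X"
  have car: "?L \<in> carrier_mat m r" "?W \<in> carrier_mat m q" "?X \<in> carrier_mat r m"
    using L W X by auto
  have XL: "?X * ?L = 1\<^sub>m r"
    using X(2) frac_mat_mult[OF X(1) L] by (simp add: frac_mat_def to_fract_hom.mat_hom_one)
  obtain T where T: "T \<in> carrier_mat r q" "?W = ?L * T"
    using span_list_cols_subset_imp_mult[OF car(1,2)] span by blast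
  obtain S where S: "S \<in> carrier_mat q r" "?L = ?W * S"
    using span_list_cols_subset_imp_mult[OF car(2,1)] span by blast
  \<comment> \<open>The coordinates \<open>T\<close> are a priori rational; multiplying
    \<open>?W = ?L * T\<close> by the left inverse shows that they are polynomial.\<close>
  have TX: "T = frac_mat (X * W)"
  proof -
    have "frac_mat (X * W) = ?X * (?L * T)" using frac_mat_mult[OF X(1) W] T(2) by simp
    also have "\<dots> = ?X * ?L * T" using car T(1) by (intro assoc_mult_mat[symmetric]) auto
    finally show ?thesis using XL T by simp
  qed
  \<comment> \<open>Now \<open>q = r\<close>: a right inverse of \<open>T\<close> gives
    \<open>r \<le> q\<close>, and the trivial kernel inherited from \<open>?W\<close> gives the
    converse.\<close>
  have "T * S = ?X * ?L * (T * S)" unfolding XL using T(1) S(1) by simp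
  also have "\<dots> = ?X * (?L * (T * S))" using car T(1) S(1) by (intro assoc_mult_mat) auto
  also have "?L * (T * S) = ?L * T * S" using car T(1) S(1) by (intro assoc_mult_mat[symmetric]) auto
  also have "\<dots> = ?L" using T(2) S(2) by simp
  finally have TS: "T * S = 1\<^sub>m r" using XL by simp
  have rq: "r \<le> q" using inner_dim_ge_of_mult_det_nonzero[OF T(1) S(1)] TS by simp
  have "q \<le> r" 
  proof (rule injective_mat_imp_dim_le[OF T(1)], unfold injective_mat_def, intro ballI impI)
    fix v assume v: "v \<in> carrier_vec (dim_col T)" and 0: "T *\<^sub>v v = 0\<^sub>v (dim_row T)"
    then have v': "v \<in> carrier_vec q" using T by simp
    have "?W *\<^sub>v v = ?L *\<^sub>v (T *\<^sub>v v)" unfolding T(2) by (rule assoc_mult_mat_vec[OF car(1) T(1) v'])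
    also have "\<dots> = 0\<^sub>v m" unfolding 0 using car T(1) by (intro eq_vecI) auto
    finally show "v = 0\<^sub>v (dim_col T)" using injW v' car T(1) unfolding injective_mat_def by auto
  qed
  with rq have q: "q = r" by simp
  define T' where "T' = X * W"
  have T': "T' \<in> carrier_mat r r" using X W q unfolding T'_def by auto
  have "det T \<noteq> 0" using det_mult[of T r S] TS T(1) S(1) q by auto
  then have detT': "det T' \<noteq> 0" unfolding TX T'_def by (simp add: det_frac_mat)
  have "frac_mat W = frac_mat (L * T')" using T(2) TX frac_mat_mult[OF L T'] unfolding T'_def by simp
  then have WT: "W = L * T'"
    unfolding frac_mat_def using W L T' q
    by (auto simp: mat_eq_iff)
  \<comment> \<open>A nonzero determinant has a nonzero Leibniz term; its permutation assigns to
    each column of \<open>L\<close> a column of \<open>W\<close> in which it has a nonzero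
    coefficient.\<close>
  obtain \<sigma> where \<sigma>: "\<sigma> permutes {0..<r}" "(\<Prod>i = 0..<r. T' $$ (i, \<sigma> i)) \<noteq> 0"
    using detT' unfolding det_def'[OF T'] by (metis (mono_tags, lifting) mem_Collect_eq mult_eq_0_iff sum.neutral)
  have ge: "vec_deg (col L i) \<le> vec_deg (col W (\<sigma> i))" if i: "i < r" for i
  proof -
    have \<sigma>i: "\<sigma> i < r" using permutes_in_image[OF \<sigma>(1), of i] i by simp
    have nz: "col T' (\<sigma> i) $ i \<noteq> 0" using \<sigma>(2) i \<sigma>i T' by auto
    have "col W (\<sigma> i) = L *\<^sub>v col T' (\<sigma> i)" unfolding WT by (rule col_mult2[OF L T' \<sigma>i])
    then obtain k where k: "k < m" "col W (\<sigma> i) $ k \<noteq> 0" "\<delta> i \<le> degree (col W (\<sigma> i) $ k)"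
      using predictable_degree[OF L red _ i nz] T' \<sigma>i
      by (metis add_leD1 carrier_matD(1) col_dim)
    have "ereal (real (\<delta> i)) \<le> ereal (real (degree (col W (\<sigma> i) $ k)))" using k(3) by simp
    also have "\<dots> \<le> vec_deg (col W (\<sigma> i))" using k W by (intro vec_deg_ge) auto
    finally show ?thesis using col_reduced_vec_deg[OF L red i] by simp
  qed
  have "(\<Sum>j<r. vec_deg (col L j)) \<le> (\<Sum>j<r. vec_deg (col W (\<sigma> j)))"
    by (intro sum_mono ge) auto
  also have "\<dots> = (\<Sum>j<q. vec_deg (col W j))"
    unfolding q using sum.permute[OF \<sigma>(1), of "\<lambda>j. vec_deg (col W j)"] by (simp add: atLeast0LessThan o_def)
  finally show "(\<Sum>j<r. vec_deg (col L j)) \<le> (\<Sum>j<q. vec_deg (col W j))" .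
qed

text \<open>A relation among the leading coefficient vectors lowers the degree of a column of maximal
  degree among those involved.\<close>
lemma col_reduction_step:
  fixes L :: "'a::field poly mat"
  assumes L: "L \<in> carrier_mat m r" and inj: "injective_mat L"
    and deg: "\<And>j. j < r \<Longrightarrow> vec_deg (col L j) = ereal (real (\<delta> j))"
    and bound: "\<And>i j. i < m \<Longrightarrow> j < r \<Longrightarrow> degree (L $$ (i,j)) \<le> \<delta> j"
    and "\<not> col_reduced \<delta> L"
  obtains W \<delta>' where "W \<in> carrier_mat r r" "unimodular W"
    "\<And>j. j < r \<Longrightarrow> vec_deg (col (L * W) j) = ereal (real (\<delta>' j))"
    "(\<Sum>j<r. \<delta>' j) < (\<Sum>j<r. \<delta> j)"
proof -
  obtain c where c: "c \<in> carrier_vec r" "lead_mat \<delta> L *\<^sub>v c = 0\<^sub>v m" "c \<noteq> 0\<^sub>v r"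
    using assms(5) L bound lead_mat_carrier[OF L, of \<delta>] unfolding col_reduced_def injective_mat_def by auto
  let ?S = "{j. j < r \<and> c $ j \<noteq> 0}"
  have "?S \<noteq> {}" using c by auto
  then have "Max (\<delta> ` ?S) \<in> \<delta> ` ?S" by (intro Max_in) auto
  then obtain k where k: "k < r" "c $ k \<noteq> 0" "\<delta> k = Max (\<delta> ` ?S)" by auto
  have kmax: "\<delta> j \<le> \<delta> k" if "j < r" "c $ j \<noteq> 0" for j
    unfolding k(3) using that by (intro Max_ge) auto
  \<comment> \<open>The relation \<open>c\<close> among leading coefficients, homogenised: each term
    of \<open>L *\<^sub>v v\<close> has degree at most \<delta> k, and the coefficients at \<delta>
    k add up to the relation, which is zero.\<close>
  define v where "v = vec r (\<lambda>j. monom (c $ j) (\<delta> k - \<delta> j))"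
  have v: "v \<in> carrier_vec r" by (simp add: v_def)
  \<comment> \<open>Replacing column \<open>k\<close> of the identity by \<open>v\<close> gives
    determinant \<open>v $ k\<close>, the nonzero constant \<open>c $ k\<close>. The maximality of
    \<delta> k keeps all exponents in \<open>v\<close> genuine differences wherever \<open>c\<close>
    is nonzero.\<close>
  define W where "W = replace_col (1\<^sub>m r) v k"
  have W: "W \<in> carrier_mat r r" by (simp add: W_def replace_col_def)
  have "det W = v $ k" 
    using cramer_lemma_mat[OF one_carrier_mat v k(1)] v by (simp add: W_def)
  then have uni: "unimodular W" using k W by (auto simp: unimodular_def v_def monom_0)
  have colW: "col W j = (if j = k then v else unit_vec r j)" if "j < r" for j
    using that v by (intro eq_vecI) (auto simp: W_def replace_col_def)
  have colLW: "col (L * W) j = (if j = k then L *\<^sub>v v else col L j)" if "j < r" for j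
    using col_mult2[OF L W that] colW[OF that] mult_mat_unit_vec[OF L that] by simp
  have Lv: "degree ((L *\<^sub>v v) $ i) \<le> \<delta> k \<and> coeff ((L *\<^sub>v v) $ i) (\<delta> k) = 0" if i: "i < m" for i
  proof
    have eq: "(L *\<^sub>v v) $ i = (\<Sum>j<r. L $$ (i,j) * monom (c $ j) (\<delta> k - \<delta> j))"
      using i L v by (simp add: scalar_prod_def v_def atLeast0LessThan)
    have le: "degree (monom (c $ j) (\<delta> k - \<delta> j)) \<le> \<delta> k - \<delta> j" for j by (rule degree_monom_le)
    show "degree ((L *\<^sub>v v) $ i) \<le> \<delta> k" unfolding eq
    proof (intro degree_sum_le)
      fix j assume "j \<in> {..<r}"
      then have j: "j < r" by simp
      show "degree (L $$ (i,j) * monom (c $ j) (\<delta> k - \<delta> j)) \<le> \<delta> k"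
      proof (cases "c $ j = 0")
        case False
        have "degree (L $$ (i,j) * monom (c $ j) (\<delta> k - \<delta> j)) \<le> \<delta> j + (\<delta> k - \<delta> j)"
          using degree_mult_le[of "L $$ (i,j)"] bound[OF i j] le[of j] by (meson add_mono order_trans)
        then show ?thesis using kmax[OF j False] by simp
      qed simp
    qed simp
    have "coeff (L $$ (i,j) * monom (c $ j) (\<delta> k - \<delta> j)) (\<delta> k) = coeff (L $$ (i,j)) (\<delta> j) * c $ j"
      if j: "j < r" for j
    proof (cases "c $ j = 0")
      case False
      have "coeff (L $$ (i,j) * monom (c $ j) (\<delta> k - \<delta> j)) (\<delta> j + (\<delta> k - \<delta> j)) 
        = coeff (L $$ (i,j)) (\<delta> j) * coeff (monom (c $ j) (\<delta> k - \<delta> j)) (\<delta> k - \<delta> j)"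
        using coeff_mult_degree_bounds[OF bound[OF i j] le] .
      then show ?thesis using kmax[OF j False] by simp
    qed simp
    then have "coeff ((L *\<^sub>v v) $ i) (\<delta> k) = (lead_mat \<delta> L *\<^sub>v c) $ i"
      unfolding eq using i L c(1) by (simp add: coeff_sum scalar_prod_def lead_mat_def atLeast0LessThan)
    then show "coeff ((L *\<^sub>v v) $ i) (\<delta> k) = 0" using c i by simp
  qed
  have "v $ k \<noteq> 0" using k by (simp add: v_def)
  then have "v \<noteq> 0\<^sub>v r" using k(1) by auto
  then have "L *\<^sub>v v \<noteq> 0\<^sub>v m" using inj v L unfolding injective_mat_def by auto
  moreover have dim: "dim_vec (L *\<^sub>v v) = m" using L by simp
  ultimately obtain d i where d: "vec_deg (L *\<^sub>v v) = ereal (real d)" "i < m" "coeff ((L *\<^sub>v v) $ i) d \<noteq> 0"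
    using vec_deg_nonzeroE[of "L *\<^sub>v v"] by metis
  have "d \<le> \<delta> k" using le_degree[OF d(3)] Lv[OF d(2)] by simp
  moreover have "d \<noteq> \<delta> k" using d(3) Lv[OF d(2)] by auto
  ultimately have "d < \<delta> k" by simp
  show ?thesis
  proof (rule that[OF W uni])
    show "vec_deg (col (L * W) j) = ereal (real ((\<delta>(k := d)) j))" if "j < r" for j
      using colLW[OF that] d(1) deg[OF that] by simp
    have "(\<Sum>j<r. (\<delta>(k := d)) j) = d + (\<Sum>j\<in>{..<r} - {k}. \<delta> j)"
      using k(1) by (subst sum.remove[of _ k]) (auto intro!: sum.cong)
    also have "\<dots> < \<delta> k + (\<Sum>j\<in>{..<r} - {k}. \<delta> j)" using \<open>d < \<delta> k\<close> by simp
    also have "\<dots> = (\<Sum>j<r. \<delta> j)"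
      using k(1) by (subst (2) sum.remove[of _ k]) auto
    finally show "(\<Sum>j<r. (\<delta>(k := d)) j) < (\<Sum>j<r. \<delta> j)" .
  qed
qed

lemma injective_mat_col_degreesE:
  fixes L :: "'a::field poly mat"
  assumes L: "L \<in> carrier_mat m r" and inj: "injective_mat L"
  obtains \<delta> where "\<And>j. j < r \<Longrightarrow> vec_deg (col L j) = ereal (real (\<delta> j))"
    "\<And>i j. i < m \<Longrightarrow> j < r \<Longrightarrow> degree (L $$ (i,j)) \<le> \<delta> j"
proof -
  have "\<exists>d. vec_deg (col L j) = ereal (real d) \<and> (\<forall>i<m. degree (L $$ (i,j)) \<le> d)" if "j < r" for j
  proof -
    have "col L j \<noteq> 0\<^sub>v (dim_vec (col L j))"
      using injective_mat_col_nonzero[OF L inj that] L by simp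
    then obtain d where "vec_deg (col L j) = ereal (real d)"
      "\<And>i. i < dim_vec (col L j) \<Longrightarrow> degree (col L j $ i) \<le> d" using vec_deg_nonzeroE by metis
    then show ?thesis using L that by (intro exI[of _ d]) auto
  qed
  then show ?thesis using that by metis
qed

text \<open>Induction on the sum of the column degrees, which every reduction step lowers.\<close>

lemma left_invertible_col_reduction:
  fixes A :: "'a::field poly mat"
  assumes "A \<in> carrier_mat m r" "left_invertible A"
  shows "\<exists>W \<delta>. W \<in> carrier_mat r r \<and> unimodular W \<and> col_reduced \<delta> (A * W)"
proof -
  have "\<exists>W \<delta>'. W \<in> carrier_mat r r \<and> unimodular W \<and> col_reduced \<delta>' (A * W)"
    if "A \<in> carrier_mat m r" "left_invertible A" 
      "\<And>j. j < r \<Longrightarrow> vec_deg (col A j) = ereal (real (\<delta> j))" for \<delta> and A :: "'a poly mat"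
    using that
  proof (induction "\<Sum>j<r. \<delta> j" arbitrary: \<delta> A rule: less_induct)
    case less
    note A = less.prems(1)
    note inj = left_invertible_imp_injective[OF less.prems(2)]
    show ?case
    proof (cases "col_reduced \<delta> A")
      case True
      then show ?thesis using A unimodular_one by (intro exI[of _ "1\<^sub>m r"] exI[of _ \<delta>]) auto
    next
      case False
      have bound: "degree (A $$ (i,j)) \<le> \<delta> j" if "i < m" "j < r" for i j
        using injective_mat_col_degreesE[OF A inj] less.prems(3) that
        by (metis ereal.inject of_nat_eq_iff)
      obtain W \<delta>' where W: "W \<in> carrier_mat r r" "unimodular W"
        and deg: "\<And>j. j < r \<Longrightarrow> vec_deg (col (A * W) j) = ereal (real (\<delta>' j))"
        and lt: "(\<Sum>j<r. \<delta>' j) < (\<Sum>j<r. \<delta> j)"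
        using col_reduction_step[OF A inj less.prems(3) bound False] by metis
      have AW: "A * W \<in> carrier_mat m r" "left_invertible (A * W)"
        using A W(1) left_invertible_mult[OF A W(1) less.prems(2)]
          unimodular_left_right_invertible(1)[OF W(2)] by auto
      obtain V \<delta>'' where V: "V \<in> carrier_mat r r" "unimodular V" "col_reduced \<delta>'' (A * W * V)"
        using less.hyps[OF lt AW deg] by blast
      have "A * W * V = A * (W * V)" using A W V by (intro assoc_mult_mat) auto
      then show ?thesis using V W unimodular_mult[OF W(1) V(1) W(2) V(2)]
        by (intro exI[of _ "W * V"] exI[of _ \<delta>'']) auto
    qed
  qed
  then show ?thesis
    using injective_mat_col_degreesE[OF assms(1) left_invertible_imp_injective[OF assms(2)]] assms by metis
qed

text \<open>Over the rational functions \<open>T\<close> is invertible, so each matrix is a right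
  multiple of the other.\<close>

lemma same_span_of_det_nonzero:
  fixes A T :: "'a::field poly mat"
  assumes A: "A \<in> carrier_mat m r" and T: "T \<in> carrier_mat r r" and det: "det T \<noteq> 0"
  shows "span_list m (cols (frac_mat (A * T))) = span_list m (cols (frac_mat A))"
proof -
  let ?A = "frac_mat A" and ?T = "frac_mat T"
  have car: "?A \<in> carrier_mat m r" "?T \<in> carrier_mat r r" using A T by auto
  have "det ?T \<noteq> 0" using det by (simp add: det_frac_mat)
  then obtain T' where T': "T' \<in> carrier_mat r r" "?T * T' = 1\<^sub>m r"
    using field_square_inverse[OF car(2)] by metis
  have AT: "frac_mat (A * T) = ?A * ?T" by (rule frac_mat_mult[OF A T])
  have "?A * ?T * T' = ?A * (?T * T')" using car T' by (intro assoc_mult_mat) auto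
  then have "?A = ?A * ?T * T'" using T' car by simp
  then show ?thesis unfolding AT
    using span_list_cols_mult_subset[OF car] 
      span_list_cols_mult_subset[OF mult_carrier_mat[OF car] T'(1)] by auto
qed

text \<open>A Leibniz product without zero factors has degree at most the sum of the
  \<open>b j\<close> minus the sum of the \<open>a j\<close>, since a permutation does not change
  the former sum.\<close>

lemma degree_det_eq_0:
  fixes T :: "'a::field poly mat"
  assumes T: "T \<in> carrier_mat r r"
    and deg: "\<And>i j. i < r \<Longrightarrow> j < r \<Longrightarrow> T $$ (i,j) \<noteq> 0 \<Longrightarrow> a i + degree (T $$ (i,j)) \<le> b j"
    and "(\<Sum>j<r. b j) \<le> (\<Sum>j<r. a j)"
  shows "degree (det T) = 0"
proof -
  have "degree (signof \<sigma> * (\<Prod>i = 0..<r. T $$ (i, \<sigma> i))) \<le> 0" if \<sigma>: "\<sigma> permutes {0..<r}" for \<sigma>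
  proof (cases "\<exists>i<r. T $$ (i, \<sigma> i) = 0")
    case True
    then have "(\<Prod>i = 0..<r. T $$ (i, \<sigma> i)) = 0" by (intro prod_zero) auto
    then show ?thesis by (simp only: mult_zero_right degree_0 order_refl)
  next
    case False
    have \<sigma>i: "\<sigma> i < r" if "i < r" for i using permutes_in_image[OF \<sigma>, of i] that by simp
    have "(\<Sum>i<r. a i) + (\<Sum>i<r. degree (T $$ (i, \<sigma> i))) \<le> (\<Sum>i<r. b (\<sigma> i))"
      unfolding sum.distrib[symmetric] using deg \<sigma>i False by (intro sum_mono) auto
    also have "\<dots> = (\<Sum>i<r. b i)"
      using sum.permute[OF \<sigma>, of b] by (simp add: atLeast0LessThan o_def)
    also note assms(3)
    finally have 0: "(\<Sum>i<r. degree (T $$ (i, \<sigma> i))) = 0" by simp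
    have "degree (\<Prod>i = 0..<r. T $$ (i, \<sigma> i)) \<le> (\<Sum>i<r. degree (T $$ (i, \<sigma> i)))"
      using degree_prod_sum_le[of "{0..<r}" "\<lambda>i. T $$ (i, \<sigma> i)"] by (simp add: atLeast0LessThan o_def)
    with 0 have "degree (\<Prod>i = 0..<r. T $$ (i, \<sigma> i)) = 0" by simp
    then show ?thesis by (simp add: sign_def)
  qed
  then have "degree (det T) \<le> 0" unfolding det_def'[OF T]
    by (intro degree_sum_le) (auto simp: finite_permutations)
  then show ?thesis by simp
qed

text \<open>Write \<open>L = M * T\<close> with \<open>M\<close> left invertible and column reduced.
  Minimality of \<open>L\<close> and predictable degrees for \<open>M\<close> make \<open>T\<close>
  unimodular, which gives left invertibility; reducedness follows because a reduction step would
  contradict minimality.\<close>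

lemma minimal_basis_imp_col_reduced:
  fixes L :: "'a::field poly mat"
  assumes L: "L \<in> carrier_mat m r" and min: "minimal_basis m (cols L)"
  shows "left_invertible L \<and> (\<exists>\<delta>. col_reduced \<delta> L)"
proof -
  have injF: "injective_mat (frac_mat L)"
    and le: "\<And>W. W \<in> carrier_mat m r \<Longrightarrow> injective_mat (frac_mat W) \<Longrightarrow>
       span_list m (cols (frac_mat W)) = span_list m (cols (frac_mat L)) \<Longrightarrow>
       (\<Sum>j<r. vec_deg (col L j)) \<le> (\<Sum>j<r. vec_deg (col W j))"
    using min unfolding minimal_basis_cols_iff[OF L] by auto
  have inj: "injective_mat L" using injF by (rule injective_frac_mat_imp_injective)
  obtain \<delta> where deg: "\<And>j. j < r \<Longrightarrow> vec_deg (col L j) = ereal (real (\<delta> j))"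
    and bound: "\<And>i j. i < m \<Longrightarrow> j < r \<Longrightarrow> degree (L $$ (i,j)) \<le> \<delta> j"
    using injective_mat_col_degreesE[OF L inj] by metis
  \<comment> \<open>Minimality against left invertible competitors, brought from extended reals down
    to natural numbers.\<close>
  have sum_le: "(\<Sum>j<r. \<delta> j) \<le> (\<Sum>j<r. \<epsilon> j)"
    if "W \<in> carrier_mat m r" "left_invertible W"
      "span_list m (cols (frac_mat W)) = span_list m (cols (frac_mat L))"
      "\<And>j. j < r \<Longrightarrow> vec_deg (col W j) = ereal (real (\<epsilon> j))" for W \<epsilon>
  proof -
    have "ereal (real (\<Sum>j<r. \<delta> j)) = (\<Sum>j<r. vec_deg (col L j))" using deg by simp
    also have "\<dots> \<le> (\<Sum>j<r. vec_deg (col W j))"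
      using le[OF that(1) left_invertible_imp_injective[OF frac_mat_left_invertible[OF that(2)]] that(3)] .
    also have "\<dots> = ereal (real (\<Sum>j<r. \<epsilon> j))" using that(4) by simp
    finally show ?thesis unfolding ereal_less_eq of_nat_le_iff .
  qed
  obtain A T0 where A: "A \<in> carrier_mat m r" and T0: "T0 \<in> carrier_mat r r" and LAT: "L = A * T0"
    and leftA: "left_invertible A" and detT0: "det T0 \<noteq> 0"
    using injective_mat_factorization[OF L inj] by metis
  obtain W \<epsilon> where W: "W \<in> carrier_mat r r" "unimodular W" "col_reduced \<epsilon> (A * W)"
    using left_invertible_col_reduction[OF A leftA] by blast
  obtain W' where W': "W' \<in> carrier_mat r r" "W * W' = 1\<^sub>m r" "unimodular W'"
    using unimodular_inverse[OF W(1,2)] by metis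
  define M T where "M = A * W" and "T = W' * T0"
  have M: "M \<in> carrier_mat m r" and T: "T \<in> carrier_mat r r"
    using A W W' T0 by (auto simp: M_def T_def)
  have leftM: "left_invertible M" unfolding M_def
    using left_invertible_mult[OF A W(1) leftA] unimodular_left_right_invertible[OF W(2)] by blast
  have "M * T = A * (W * (W' * T0))" unfolding M_def T_def
    using A W(1) W'(1) T0 by (intro assoc_mult_mat) auto
  also have "W * (W' * T0) = W * W' * T0" using W(1) W'(1) T0 by (intro assoc_mult_mat[symmetric]) auto
  finally have LMT: "L = M * T" unfolding LAT W'(2) using T0 by simp
  have detT: "det T \<noteq> 0" unfolding T_def using det_mult[OF W'(1) T0] detT0 W'(3) by (simp add: unimodular_def)
  \<comment> \<open>\<open>M\<close> spans the same rational subspace as \<open>L\<close>, so it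
    competes with \<open>L\<close>. The entry bounds on \<open>T\<close> that follow give the
    opposite tendency, and together they leave \<open>det T\<close> no positive degree.\<close>
  have "(\<Sum>j<r. \<delta> j) \<le> (\<Sum>j<r. \<epsilon> j)"
    using sum_le[OF M leftM same_span_of_det_nonzero[OF M T detT, folded LMT, symmetric]
        col_reduced_vec_deg[OF M W(3)[folded M_def]]] .
  moreover have "\<epsilon> i + degree (T $$ (i,j)) \<le> \<delta> j" if ij: "i < r" "j < r" "T $$ (i,j) \<noteq> 0" for i j
  proof -
    have "col L j = M *\<^sub>v col T j" unfolding LMT by (rule col_mult2[OF M T ij(2)])
    then obtain q where "q < m" "\<epsilon> i + degree (T $$ (i,j)) \<le> degree (col L j $ q)"
      using predictable_degree[OF M, of \<epsilon> "col T j" i] W(3) ij T unfolding M_def by auto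
    then show ?thesis using bound[of q j] ij L by simp
  qed
  ultimately have "degree (det T) = 0" using degree_det_eq_0[OF T] by blast
  then have "unimodular T" using T detT by (simp add: unimodular_def)
  then have left: "left_invertible L"
    unfolding LMT using left_invertible_mult[OF M T leftM] unimodular_left_right_invertible by blast
  \<comment> \<open>Otherwise one reduction step would produce a basis of the same subspace with
    smaller degree sum; left invertibility, just shown, is inherited by it.\<close>
  have "col_reduced \<delta> L"
  proof (rule ccontr)
    assume "\<not> col_reduced \<delta> L"
    then obtain V \<epsilon> where V: "V \<in> carrier_mat r r" "unimodular V"
      "\<And>j. j < r \<Longrightarrow> vec_deg (col (L * V) j) = ereal (real (\<epsilon> j))" 
      and lt: "(\<Sum>j<r. \<epsilon> j) < (\<Sum>j<r. \<delta> j)"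
      using col_reduction_step[OF L inj deg bound] by metis
    have "left_invertible (L * V)"
      using left_invertible_mult[OF L V(1) left] unimodular_left_right_invertible[OF V(2)] by blast
    moreover have "span_list m (cols (frac_mat (L * V))) = span_list m (cols (frac_mat L))"
      using same_span_of_det_nonzero[OF L V(1)] V(2) by (simp add: unimodular_def)
    ultimately have "(\<Sum>j<r. \<delta> j) \<le> (\<Sum>j<r. \<epsilon> j)"
      using sum_le[OF mult_carrier_mat[OF L V(1)]] V(3) by blast
    with lt show False by simp
  qed
  with left show ?thesis by blast
qed

section \<open>Reversal and factorization\<close>

lemma coeff_rev_poly: "coeff (rev_poly d p) i = (if i \<le> d then coeff p (d - i) else 0)"
proof -
  have "coeff (rev_poly d p) i = (\<Sum>j\<le>d. if d - j = i then coeff p j else 0)"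
    unfolding rev_poly_def by (simp add: coeff_sum)
  also have "\<dots> = (\<Sum>j\<le>d. if j = d - i then (if i \<le> d then coeff p (d - i) else 0) else 0)"
    by (intro sum.cong) auto
  also have "\<dots> = (if i \<le> d then coeff p (d - i) else 0)" by simp
  finally show ?thesis .
qed

lemma poly_rev_poly_0 [simp]: "poly (rev_poly d p) 0 = coeff p d"
  by (simp add: poly_0_coeff_0 coeff_rev_poly)

lemma rev_poly_0 [simp]: "rev_poly d 0 = 0"
  by (simp add: poly_eq_iff coeff_rev_poly)

lemma rev_poly_1: "rev_poly d 1 = monom 1 d"
  by (auto simp: poly_eq_iff coeff_rev_poly)

lemma rev_poly_sum: "rev_poly d (\<Sum>x\<in>S. f x) = (\<Sum>x\<in>S. rev_poly d (f x))"
  by (simp add: poly_eq_iff coeff_rev_poly coeff_sum)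

lemma rev_poly_conv_reflect_poly:
  assumes "degree p \<le> d"
  shows "rev_poly d p = monom 1 (d - degree p) * reflect_poly p"
proof (rule poly_eqI)
  fix i
  show "coeff (rev_poly d p) i = coeff (monom 1 (d - degree p) * reflect_poly p) i"
    using assms by (auto simp: coeff_rev_poly coeff_monom_mult coeff_reflect_poly coeff_eq_0
        intro!: arg_cong[of _ _ "coeff p"])
qed

text \<open>Reversal with respect to a degree bound is \<open>reflect_poly\<close> times a power of
  the variable. The surplus exponents add up, and \<open>reflect_poly\<close> is
  multiplicative.\<close>

lemma rev_poly_mult:
  fixes p q :: "'a::field poly"
  assumes "degree p \<le> a" "degree q \<le> b"
  shows "rev_poly (a + b) (p * q) = rev_poly a p * rev_poly b q"
proof (cases "p = 0 \<or> q = 0")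
  case False
  then have deg: "degree (p * q) = degree p + degree q" by (simp add: degree_mult_eq)
  have "a + b - degree (p * q) = (a - degree p) + (b - degree q)" using deg assms by simp
  then have "monom 1 (a + b - degree (p * q)) = monom 1 (a - degree p) * monom (1 :: 'a) (b - degree q)"
    by (simp add: mult_monom)
  moreover have "degree (p * q) \<le> a + b" using deg assms by simp
  ultimately show ?thesis
    using assms by (simp only: rev_poly_conv_reflect_poly reflect_poly_mult mult_ac)
qed auto

text \<open>Under the degree bounds this is L(1/\<lambda>) multiplied on the right by the diagonal
  matrix of the powers \<lambda>^(\<delta> j); its value at 0 is
  \<open>lead_mat \<delta> L\<close>.\<close>

definition rev_cols :: "(nat \<Rightarrow> nat) \<Rightarrow> 'a::field poly mat \<Rightarrow> 'a poly mat" where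
  "rev_cols \<delta> L = mat (dim_row L) (dim_col L) (\<lambda>(i,j). rev_poly (\<delta> j) (L $$ (i,j)))"

definition rev_rows :: "(nat \<Rightarrow> nat) \<Rightarrow> 'a::field poly mat \<Rightarrow> 'a poly mat" where
  "rev_rows \<epsilon> R = mat (dim_row R) (dim_col R) (\<lambda>(i,j). rev_poly (\<epsilon> i) (R $$ (i,j)))"

lemma rev_cols_carrier [simp]: "L \<in> carrier_mat m r \<Longrightarrow> rev_cols \<delta> L \<in> carrier_mat m r"
  by (simp add: rev_cols_def)

lemma rev_rows_carrier [simp]: "R \<in> carrier_mat m r \<Longrightarrow> rev_rows \<delta> R \<in> carrier_mat m r"
  by (simp add: rev_rows_def)

lemma rev_mat_mult:
  assumes L: "L \<in> carrier_mat m r" and R: "R \<in> carrier_mat r n"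
    and "\<And>i j. i < m \<Longrightarrow> j < r \<Longrightarrow> degree (L $$ (i,j)) \<le> \<delta> j"
    and "\<And>i j. i < r \<Longrightarrow> j < n \<Longrightarrow> degree (R $$ (i,j)) \<le> \<epsilon> i"
    and "\<And>i. i < r \<Longrightarrow> \<delta> i + \<epsilon> i = d"
  shows "rev_mat d (L * R) = rev_cols \<delta> L * rev_rows \<epsilon> R"
proof (rule eq_matI)
  fix i j assume "i < dim_row (rev_cols \<delta> L * rev_rows \<epsilon> R)" "j < dim_col (rev_cols \<delta> L * rev_rows \<epsilon> R)"
  then have ij: "i < m" "j < n" using L R by (auto simp: rev_cols_def rev_rows_def)
  have "rev_mat d (L * R) $$ (i,j) = (\<Sum>k<r. rev_poly d (L $$ (i,k) * R $$ (k,j)))"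
    using ij L R by (simp add: rev_mat_def scalar_prod_def rev_poly_sum atLeast0LessThan)
  also have "\<dots> = (\<Sum>k<r. rev_poly (\<delta> k) (L $$ (i,k)) * rev_poly (\<epsilon> k) (R $$ (k,j)))"
    using ij assms(3-5) by (intro sum.cong refl) (metis lessThan_iff rev_poly_mult)
  also have "\<dots> = (rev_cols \<delta> L * rev_rows \<epsilon> R) $$ (i,j)"
    using ij L R by (simp add: rev_cols_def rev_rows_def scalar_prod_def atLeast0LessThan)
  finally show "rev_mat d (L * R) $$ (i,j) = (rev_cols \<delta> L * rev_rows \<epsilon> R) $$ (i,j)" .
qed (use L R in \<open>auto simp: rev_mat_def rev_cols_def rev_rows_def\<close>)

section \<open>Evaluation at zero\<close>

abbreviation eval_0 :: "'a::field poly mat \<Rightarrow> 'a mat" where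
  "eval_0 \<equiv> map_mat (\<lambda>p. poly p 0)"

lemma comm_ring_hom_eval_0: "comm_ring_hom (\<lambda>p :: 'a::field poly. poly p 0)"
  by unfold_locales auto

lemma det_eval_0: "det (eval_0 A) = poly (det A) 0"
  by (rule comm_ring_hom.hom_det[OF comm_ring_hom_eval_0])

lemma eval_0_mult:
  assumes "A \<in> carrier_mat m k" "B \<in> carrier_mat k n"
  shows "eval_0 (A * B) = eval_0 A * eval_0 B"
proof -
  have "semiring_hom (\<lambda>p :: 'a poly. poly p 0)" by unfold_locales auto
  then show ?thesis using assms by (rule semiring_hom.mat_hom_mult)
qed

lemma eval_0_const: "eval_0 (map_mat (\<lambda>a. [:a:]) C) = C"
  by (intro eq_matI) auto

lemma eval_0_rev_cols: "eval_0 (rev_cols \<delta> L) = lead_mat \<delta> L"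
  by (intro eq_matI) (auto simp: rev_cols_def lead_mat_def)

lemma eval_0_rev_rows: "eval_0 (rev_rows \<epsilon> R) = transpose_mat (lead_mat \<epsilon> (transpose_mat R))"
  by (intro eq_matI) (auto simp: rev_rows_def lead_mat_def)

text \<open>Reversing \<open>R * Y = 1\<close> turns the identity into a diagonal matrix of
  monomials, so the reversed \<open>R\<close> keeps full row rank over the rational functions,
  though perhaps not at 0.\<close>

lemma rev_rows_right_invertible_det_nonzero:
  fixes R :: "'a::field poly mat"
  assumes R: "R \<in> carrier_mat r n" and "right_invertible R"
    and deg: "\<And>i j. i < r \<Longrightarrow> j < n \<Longrightarrow> degree (R $$ (i,j)) \<le> \<epsilon> i"
  obtains Y where "Y \<in> carrier_mat n r" "det (rev_rows \<epsilon> R * Y) \<noteq> 0"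
proof -
  obtain Y where Y: "Y \<in> carrier_mat n r" "R * Y = 1\<^sub>m r"
    using assms unfolding right_invertible_def by auto
  \<comment> \<open>The sum of all entry degrees serves as a crude common degree bound for
    \<open>Y\<close>.\<close>
  define N where "N = (\<Sum>i<n. \<Sum>j<r. degree (Y $$ (i,j)))"
  have degY: "degree (Y $$ (i,j)) \<le> N" if "i < n" "j < r" for i j
  proof -
    have "degree (Y $$ (i,j)) \<le> (\<Sum>j<r. degree (Y $$ (i,j)))"
      using that by (intro member_le_sum) auto
    also have "\<dots> \<le> N" unfolding N_def
      using that by (intro member_le_sum[where f = "\<lambda>i. \<Sum>j<r. degree (Y $$ (i,j))"]) auto
    finally show ?thesis .
  qed
  define Z where "Z = rev_cols (\<lambda>_. N) Y"
  have Z: "Z \<in> carrier_mat n r" using Y by (simp add: Z_def)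
  let ?M = "rev_rows \<epsilon> R * Z"
  have M: "?M \<in> carrier_mat r r" by (rule mult_carrier_mat[OF rev_rows_carrier[OF R] Z])
  have entry: "?M $$ (i,j) = (if i = j then monom 1 (\<epsilon> i + N) else 0)" if ij: "i < r" "j < r" for i j
  proof -
    have "?M $$ (i,j) = (\<Sum>k<n. rev_poly (\<epsilon> i) (R $$ (i,k)) * rev_poly N (Y $$ (k,j)))"
      using ij R Y by (simp add: Z_def rev_cols_def rev_rows_def scalar_prod_def atLeast0LessThan)
    also have "\<dots> = (\<Sum>k<n. rev_poly (\<epsilon> i + N) (R $$ (i,k) * Y $$ (k,j)))"
      using ij deg degY by (intro sum.cong refl) (simp add: rev_poly_mult)
    also have "\<dots> = rev_poly (\<epsilon> i + N) ((R * Y) $$ (i,j))"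
      using ij R Y(1) by (simp add: scalar_prod_def rev_poly_sum atLeast0LessThan)
    also have "\<dots> = (if i = j then monom 1 (\<epsilon> i + N) else 0)"
      unfolding Y(2) using ij by (simp add: rev_poly_1)
    finally show ?thesis .
  qed
  have "det ?M = prod_list (diag_mat ?M)"
    using entry M by (intro det_upper_triangular[OF _ M] upper_triangularI) auto
  also have "\<dots> \<noteq> 0"
    using entry M by (auto simp: prod_list_zero_iff diag_mat_def monom_eq_0_iff)
  finally show ?thesis using that[OF Z] by blast
qed

section \<open>From the factorization to degree and eigenvalues, and back\<close>

lemma mat_deg_eqI:
  fixes P :: "'a::field poly mat"
  assumes P: "P \<in> carrier_mat m n" and "\<And>i j. i < m \<Longrightarrow> j < n \<Longrightarrow> degree (P $$ (i,j)) \<le> d"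
    and ij: "i < m" "j < n" and "coeff (P $$ (i,j)) d \<noteq> 0"
  shows "mat_deg P = ereal (real d)"
proof -
  let ?S = "{degree (P $$ (i,j)) | i j. i < dim_row P \<and> j < dim_col P}"
  have "degree (P $$ (i,j)) = d" using assms le_degree[of "P $$ (i,j)" d] by (intro antisym) auto
  then have "d \<in> ?S" using P ij by auto
  moreover have "?S = (\<lambda>(i,j). degree (P $$ (i,j))) ` ({..<dim_row P} \<times> {..<dim_col P})" by auto
  then have "finite ?S" by simp
  ultimately have "Max ?S = d" using assms by (intro Max_eqI) auto
  moreover have "P \<noteq> 0\<^sub>m (dim_row P) (dim_col P)"
    using assms by (metis carrier_matD coeff_0 index_zero_mat(1))
  ultimately show ?thesis by (simp add: mat_deg_def)
qed

lemma no_eigenvalues_of_reduced_factorization: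
  fixes L R :: "'a::field poly mat"
  assumes L: "L \<in> carrier_mat m r" and R: "R \<in> carrier_mat r n" and r: "0 < r"
    and leftL: "left_invertible L" and redL: "col_reduced \<delta> L"
    and leftR: "left_invertible (transpose_mat R)" and redR: "col_reduced \<epsilon> (transpose_mat R)"
    and sum: "\<And>i. i < r \<Longrightarrow> \<delta> i + \<epsilon> i = d"
    and deg: "\<And>i j. i < m \<Longrightarrow> j < n \<Longrightarrow> degree ((L * R) $$ (i,j)) \<le> d"
  shows "normal_rank (L * R) = r \<and> mat_deg (L * R) = ereal (real d) \<and>
    \<not> has_finite_eigenvalue (L * R) \<and> \<not> has_infinite_eigenvalue d (L * R)"
proof (intro conjI)
  have rightR: "right_invertible R" using leftR by (simp add: left_invertible_transpose)
  show "normal_rank (L * R) = r" by (rule normal_rank_mult[OF L R leftL rightR])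
  let ?P = "L * R" and ?L = "rev_cols \<delta> L" and ?R = "rev_rows \<epsilon> R"
  have P: "?P \<in> carrier_mat m n" using L R by simp
  have revP: "rev_mat d ?P = ?L * ?R"
    using redL redR L R sum by (intro rev_mat_mult) (auto simp: col_reduced_def)
  have cL: "?L \<in> carrier_mat m r" and cR: "?R \<in> carrier_mat r n" using L R by auto

  show "\<not> has_finite_eigenvalue ?P"
  proof
    assume "has_finite_eigenvalue ?P"
    then obtain es e where es: "invariant_polys ?P es" "e \<in> set es" "degree e > 0"
      unfolding has_finite_eigenvalue_def by auto
    obtain X where X: "X \<in> carrier_mat r m" "X * L = 1\<^sub>m r"
      using leftL L unfolding left_invertible_def by auto
    obtain Y where Y: "Y \<in> carrier_mat n r" "R * Y = 1\<^sub>m r"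
      using rightR R unfolding right_invertible_def by auto
    have "X * ?P = (X * L) * R" by (rule assoc_mult_mat[OF X(1) L R, symmetric])
    then have "X * ?P * Y = 1\<^sub>m r" using X Y R by simp
    then have "e dvd 1"
      using invariant_polys_det_mult(2)[OF es(1) P X(1) Y(1) invariant_polys_length_le[OF es(1) L R] es(2)]
      by simp
    with es(3) show False using poly_dvd_1[of e] by simp
  qed

  \<comment> \<open>The leading matrices of \<open>L\<close> and of the rows of \<open>R\<close> are
    the values at 0 of the reversed factors; their constant one-sided inverses compress the value of
    the reversal at 0 to the identity.\<close>
  obtain X0 where X0: "X0 \<in> carrier_mat r m" "X0 * lead_mat \<delta> L = 1\<^sub>m r"
    using injective_mat_imp_left_invertible[OF lead_mat_carrier[OF L], of \<delta>] redL lead_mat_carrier[OF L, of \<delta>]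
    unfolding left_invertible_def col_reduced_def by auto
  have tR: "transpose_mat R \<in> carrier_mat n r" using R by simp
  have "right_invertible (eval_0 ?R)" unfolding eval_0_rev_rows
    using injective_mat_imp_left_invertible[OF lead_mat_carrier[OF tR], of \<epsilon>] redR
    unfolding left_invertible_transpose[symmetric] col_reduced_def by simp
  then obtain Y0 where Y0: "Y0 \<in> carrier_mat n r" "eval_0 ?R * Y0 = 1\<^sub>m r"
    using cR unfolding right_invertible_def by auto
  have "X0 * eval_0 (rev_mat d ?P) = X0 * (lead_mat \<delta> L * eval_0 ?R)"
    unfolding revP eval_0_mult[OF cL cR] eval_0_rev_cols ..
  also have "\<dots> = X0 * lead_mat \<delta> L * eval_0 ?R"
    using X0(1) L cR by (intro assoc_mult_mat[symmetric]) auto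
  finally have one: "X0 * eval_0 (rev_mat d ?P) * Y0 = 1\<^sub>m r"
    using X0(2) Y0 cR by simp

  show "\<not> has_infinite_eigenvalue d ?P"
  proof
    assume "has_infinite_eigenvalue d ?P"
    then obtain es e where es: "invariant_polys (rev_mat d ?P) es" "e \<in> set es" "poly e 0 = 0"
      unfolding has_infinite_eigenvalue_def by auto
    \<comment> \<open>Viewed as polynomial matrices, the constant inverses give a product whose
      determinant has value 1 at 0. An invariant polynomial dividing this determinant cannot vanish
      at 0.\<close>
    define X where "X = map_mat (\<lambda>a. [:a:]) X0"
    define Y where "Y = map_mat (\<lambda>a. [:a:]) Y0"
    have X: "X \<in> carrier_mat r m" and Y: "Y \<in> carrier_mat n r" using X0 Y0 by (auto simp: X_def Y_def)
    have rP: "rev_mat d ?P \<in> carrier_mat m n" using P by (simp add: rev_mat_def)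
    have len: "length es \<le> r"
      using es(1) cL cR unfolding revP by (rule invariant_polys_length_le)
    have "eval_0 (X * rev_mat d ?P * Y) = 1\<^sub>m r"
      using one eval_0_mult[OF mult_carrier_mat[OF X rP] Y] eval_0_mult[OF X rP]
      by (simp add: X_def Y_def eval_0_const)
    then have "poly (det (X * rev_mat d ?P * Y)) 0 = 1" using det_eval_0 by (metis det_one)
    moreover have "e dvd det (X * rev_mat d ?P * Y)"
      using invariant_polys_det_mult(2)[OF es(1) rP X Y len es(2)] .
    ultimately show False using es(3) by (auto elim!: dvdE)
  qed

  \<comment> \<open>The value of the reversal at 0 is the coefficient matrix of degree
    \<open>d\<close>; if it were zero, so would be its compression, the identity of positive size
    \<open>r\<close>.\<close>
  have "\<exists>i<m. \<exists>j<n. coeff (?P $$ (i,j)) d \<noteq> 0"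
  proof (rule ccontr)
    assume "\<not> ?thesis"
    then have "eval_0 (rev_mat d ?P) = 0\<^sub>m m n"
      using L R by (intro eq_matI) (auto simp: rev_mat_def)
    then have "(1\<^sub>m r :: 'a mat) = 0\<^sub>m r r" using one X0(1) Y0(1) by simp
    then have "(1\<^sub>m r :: 'a mat) $$ (0,0) = 0" using r by simp
    then show False using r by simp
  qed
  then show "mat_deg ?P = ereal (real d)" using mat_deg_eqI[OF P deg] by blast
qed

text \<open>First the reversal \<open>?Q\<close> is shown to have exactly \<open>r\<close> invariant
  polynomials. Their product is nonzero at 0 and is a multiple of det (\<open>?R * Y'\<close>) for
  some \<open>Y'\<close>, so \<open>?R\<close> has full row rank at 0.\<close>

lemma row_reduced_if_no_infinite_eigenvalue:
  fixes L R :: "'a::field poly mat"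
  assumes L: "L \<in> carrier_mat m r" and R: "R \<in> carrier_mat r n"
    and redL: "col_reduced \<delta> L" and rightR: "right_invertible R"
    and degR: "\<And>i j. i < r \<Longrightarrow> j < n \<Longrightarrow> degree (R $$ (i,j)) \<le> \<epsilon> i"
    and sum: "\<And>i. i < r \<Longrightarrow> \<delta> i + \<epsilon> i = d"
    and inf: "\<not> has_infinite_eigenvalue d (L * R)"
  shows "col_reduced \<epsilon> (transpose_mat R)"
proof -
  let ?Q = "rev_mat d (L * R)" and ?L = "rev_cols \<delta> L" and ?R = "rev_rows \<epsilon> R"
  have Q: "?Q = ?L * ?R"
    using redL L by (intro rev_mat_mult[OF L R _ degR sum]) (auto simp: col_reduced_def)
  have cL: "?L \<in> carrier_mat m r" and cR: "?R \<in> carrier_mat r n" using L R by auto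
  have cQ: "?Q \<in> carrier_mat m n" unfolding Q using cL cR by simp
  obtain es where es: "invariant_polys ?Q es" using invariant_polys_exists by blast
  have nz: "poly e 0 \<noteq> 0" if "e \<in> set es" for e
    using inf es that unfolding has_infinite_eigenvalue_def by auto

  obtain X0 where X0: "X0 \<in> carrier_mat r m" "X0 * lead_mat \<delta> L = 1\<^sub>m r"
    using injective_mat_imp_left_invertible[OF lead_mat_carrier[OF L], of \<delta>] redL lead_mat_carrier[OF L, of \<delta>]
    unfolding left_invertible_def col_reduced_def by auto
  define X where "X = map_mat (\<lambda>a. [:a:]) X0"
  have X: "X \<in> carrier_mat r m" using X0 by (simp add: X_def)
  have "eval_0 (X * ?L) = 1\<^sub>m r"
    unfolding eval_0_mult[OF X cL] eval_0_rev_cols using X0 by (simp add: X_def eval_0_const)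
  then have "poly (det (X * ?L)) 0 \<noteq> 0" using det_eval_0 by (metis det_one one_neq_zero)
  then have detX: "det (X * ?L) \<noteq> 0" by auto
  obtain Y where Y: "Y \<in> carrier_mat n r" "det (?R * Y) \<noteq> 0"
    using rev_rows_right_invertible_det_nonzero[where \<epsilon> = \<epsilon>, OF R rightR degR] by metis
  \<comment> \<open>Every \<open>r\<close> by \<open>r\<close> compression of \<open>?Q\<close>
    splits between the reversed factors. This is used twice: first to count the invariant
    polynomials, then to isolate the contribution of \<open>?R\<close>.\<close>
  have split: "det (X' * ?Q * Y') = det (X' * ?L) * det (?R * Y')"
    if "X' \<in> carrier_mat r m" "Y' \<in> carrier_mat n r" for X' Y'
  proof -
    have "X' * ?Q = X' * ?L * ?R" unfolding Q by (rule assoc_mult_mat[OF that(1) cL cR, symmetric])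
    then have "X' * ?Q * Y' = (X' * ?L) * (?R * Y')"
      using assoc_mult_mat[OF mult_carrier_mat[OF that(1) cL] cR that(2)] by simp
    then show ?thesis 
      using det_mult[OF mult_carrier_mat[OF that(1) cL] mult_carrier_mat[OF cR that(2)]] by simp
  qed
  \<comment> \<open>For this compression both factors have nonzero determinant: the left one already
    at 0, the right one as a polynomial.\<close>
  have "r \<le> length es"
    using invariant_polys_det_mult(1)[OF es cQ X Y(1)] split[OF X Y(1)] detX Y(2) by simp
  moreover have "length es \<le> r" using es cL cR unfolding Q by (rule invariant_polys_length_le)
  ultimately have len: "r = length es" by simp
  obtain A D B where A: "A \<in> carrier_mat m r" and D: "D \<in> carrier_mat r r" and B: "B \<in> carrier_mat r n"
    and eq: "?Q = A * D * B" and "left_invertible A" "right_invertible B" and detD: "det D = prod_list es"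
    using invariant_polys_factorization[OF es cQ len] by metis
  then obtain X' Y' where X': "X' \<in> carrier_mat r m" "X' * A = 1\<^sub>m r"
    and Y': "Y' \<in> carrier_mat n r" "B * Y' = 1\<^sub>m r"
    unfolding left_invertible_def right_invertible_def by auto
  have "X' * ?Q = X' * (A * D) * B" unfolding eq
    by (rule assoc_mult_mat[OF X'(1) mult_carrier_mat[OF A D] B, symmetric])
  also have "X' * (A * D) = D" using assoc_mult_mat[OF X'(1) A D] X' D by simp
  finally have "X' * ?Q * Y' = D" using assoc_mult_mat[OF D B Y'(1)] Y' D by simp
  then have "det (X' * ?L) * det (?R * Y') = prod_list es" using split[OF X'(1) Y'(1)] detD by simp
  moreover have "poly (prod_list es) 0 \<noteq> 0"
    using nz by (induction es) auto
  ultimately have "poly (det (?R * Y')) 0 \<noteq> 0" by (metis mult_eq_0_iff poly_mult)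
  then have nz': "det (eval_0 ?R * eval_0 Y') \<noteq> 0"
    using det_eval_0[of "?R * Y'"] eval_0_mult[OF cR Y'(1)] by simp
  have ceR: "eval_0 ?R \<in> carrier_mat r n" and ceY: "eval_0 Y' \<in> carrier_mat n r"
    using cR Y' by auto
  obtain T where T: "T \<in> carrier_mat r r" "eval_0 ?R * eval_0 Y' * T = 1\<^sub>m r"
    using field_square_inverse[OF mult_carrier_mat[OF ceR ceY] nz'] by metis
  have "eval_0 ?R * (eval_0 Y' * T) = 1\<^sub>m r"
    using T assoc_mult_mat[OF ceR ceY T(1)] by simp
  then have "right_invertible (eval_0 ?R)"
    unfolding right_invertible_def carrier_matD[OF ceR] using mult_carrier_mat[OF ceY T(1)] by blast
  then have "left_invertible (lead_mat \<epsilon> (transpose_mat R))"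
    unfolding eval_0_rev_rows left_invertible_transpose[symmetric] by simp
  then have "injective_mat (lead_mat \<epsilon> (transpose_mat R))" by (rule left_invertible_imp_injective)
  then show ?thesis using degR R unfolding col_reduced_def by auto
qed

lemma reduced_factorization_exists:
  fixes P :: "'a::field poly mat"
  assumes P: "P \<in> carrier_mat m n" and deg: "\<And>i j. i < m \<Longrightarrow> j < n \<Longrightarrow> degree (P $$ (i,j)) \<le> d"
    and rank: "normal_rank P = r" and fin: "\<not> has_finite_eigenvalue P"
    and inf: "\<not> has_infinite_eigenvalue d P"
  obtains L R \<delta> \<epsilon> where "L \<in> carrier_mat m r" "R \<in> carrier_mat r n" "P = L * R"
    "left_invertible L" "col_reduced \<delta> L"
    "left_invertible (transpose_mat R)" "col_reduced \<epsilon> (transpose_mat R)"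
    "\<And>i. i < r \<Longrightarrow> \<delta> i + \<epsilon> i = d"
proof -
  obtain es where es: "invariant_polys P es" using invariant_polys_exists by blast
  have len: "r = length es" using normal_rank_eq_length_invariant_polys[OF es] rank by simp
  obtain A D B where A: "A \<in> carrier_mat m r" and D: "D \<in> carrier_mat r r" and B: "B \<in> carrier_mat r n"
    and eq: "P = A * D * B" and leftA: "left_invertible A" and rightB: "right_invertible B"
    and detD: "det D = prod_list es" "det D \<noteq> 0"
    using invariant_polys_factorization[OF es P len] by metis
  \<comment> \<open>Without finite eigenvalues all invariant polynomials are constant, so
    \<open>D\<close> is unimodular and may go into the right factor.\<close>
  have "degree e = 0" if "e \<in> set es" for e
    using fin es that unfolding has_finite_eigenvalue_def by auto
  then have "degree (prod_list es) = 0"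
  proof (induction es)
    case (Cons e es)
    then show ?case using degree_mult_le[of e "prod_list es"] by simp
  qed simp
  then have uniD: "unimodular D" using detD D by (simp add: unimodular_def)
  obtain W \<delta> where W: "W \<in> carrier_mat r r" "unimodular W" and red: "col_reduced \<delta> (A * W)"
    using left_invertible_col_reduction[OF A leftA] by blast
  obtain W' where W': "W' \<in> carrier_mat r r" "W * W' = 1\<^sub>m r" "unimodular W'"
    using unimodular_inverse[OF W] by metis
  define L R where "L = A * W" and "R = W' * (D * B)"
  have DB: "D * B \<in> carrier_mat r n" using D B by simp
  have L: "L \<in> carrier_mat m r" and R: "R \<in> carrier_mat r n"
    using A W W' DB by (auto simp: L_def R_def)
  have "L * R = A * (W * R)" unfolding L_def by (rule assoc_mult_mat[OF A W(1) R])
  also have "W * R = W * W' * (D * B)" unfolding R_def by (rule assoc_mult_mat[OF W(1) W'(1) DB, symmetric])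
  also have "\<dots> = D * B" unfolding W'(2) by (rule left_mult_one_mat[OF DB])
  also have "A * (D * B) = P" unfolding eq by (rule assoc_mult_mat[OF A D B, symmetric])
  finally have PLR: "P = L * R" ..
  have leftL: "left_invertible L"
    unfolding L_def using left_invertible_mult[OF A W(1) leftA unimodular_left_right_invertible(1)[OF W(2)]] .
  have "right_invertible (D * B)"
    using right_invertible_mult[OF D B unimodular_left_right_invertible(2)[OF uniD] rightB] .
  then have rightR: "right_invertible R"
    unfolding R_def using right_invertible_mult[OF W'(1) DB unimodular_left_right_invertible(2)[OF W'(3)]] by blast
  have redL: "col_reduced \<delta> L" using red by (simp add: L_def)
  \<comment> \<open>The degree of \<open>P\<close> is at most \<open>d\<close> and its columns are
    \<open>L\<close> applied to the columns of \<open>R\<close>, so predictable degrees for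
    \<open>L\<close> bound the entries of \<open>R\<close>.\<close>
  have bound: "\<delta> i + degree (R $$ (i,j)) \<le> d" if ij: "i < r" "j < n" "R $$ (i,j) \<noteq> 0" for i j
  proof -
    have "col P j = L *\<^sub>v col R j" unfolding PLR by (rule col_mult2[OF L R ij(2)])
    then obtain k where k: "k < m" "\<delta> i + degree (R $$ (i,j)) \<le> degree (col P j $ k)"
      using predictable_degree[OF L redL, of "col R j" i] R ij by auto
    then have "degree (col P j $ k) \<le> d" using deg[OF k(1) ij(2)] P k(1) ij(2) by simp
    with k(2) show ?thesis by simp
  qed
  have tR: "transpose_mat R \<in> carrier_mat n r" using R by simp
  have leftR: "left_invertible (transpose_mat R)" using rightR by (simp add: left_invertible_transpose)
  \<comment> \<open>Row \<open>i\<close> of \<open>R\<close> has a nonzero entry because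
    \<open>R\<close> is right invertible, so the bound applies to it; this makes the truncated
    difference \<open>d - \<delta> i\<close> below a true one.\<close>
  have le: "\<delta> i \<le> d" if i: "i < r" for i
  proof -
    have "col (transpose_mat R) i \<noteq> 0\<^sub>v n"
      using injective_mat_col_nonzero[OF tR left_invertible_imp_injective[OF leftR] i] .
    then obtain j where "j < n" "col (transpose_mat R) i $ j \<noteq> 0"
      using tR by (metis carrier_matD(1) dim_col eq_vecI index_zero_vec)
    then have "R $$ (i,j) \<noteq> 0" using R i by simp
    then show ?thesis using bound[OF i \<open>j < n\<close>] by simp
  qed
  define \<epsilon> where "\<epsilon> i = d - \<delta> i" for i
  have sum: "\<delta> i + \<epsilon> i = d" if "i < r" for i using le[OF that] by (simp add: \<epsilon>_def)
  have degR: "degree (R $$ (i,j)) \<le> \<epsilon> i" if "i < r" "j < n" for i j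
    using bound[OF that] by (cases "R $$ (i,j) = 0") (auto simp: \<epsilon>_def)
  have "col_reduced \<epsilon> (transpose_mat R)"
    using row_reduced_if_no_infinite_eigenvalue[OF L R redL rightR degR sum] inf unfolding PLR by simp
  then show ?thesis using that[OF L R PLR leftL redL leftR _ sum] by blast
qed

theorem theorem3p19:
  fixes P :: "'a::field poly mat" and m n d r :: nat
  assumes "m > 0" and "n > 0" and "d > 0"
    and "P \<in> carrier_mat m n"
    and "\<forall>i<m. \<forall>j<n. degree (P $$ (i, j)) \<le> d"
    and "0 < r" and "r \<le> min m n"
  shows "(normal_rank P = r \<and> mat_deg P = ereal (real d) \<and>
          \<not> has_finite_eigenvalue P \<and> \<not> has_infinite_eigenvalue d P)
     \<longleftrightarrow>
     (\<exists>L R. L \<in> carrier_mat m r \<and> R \<in> carrier_mat r n \<and> P = L * R \<and>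
        minimal_basis m (cols L) \<and> minimal_basis n (rows R) \<and>
        (\<forall>i<r. vec_deg (col L i) + vec_deg (row R i) = ereal (real d)))"
  (is "?spectral \<longleftrightarrow> ?factorization")
proof
  assume ?spectral
  then obtain L R \<delta> \<epsilon> where L: "L \<in> carrier_mat m r" and R: "R \<in> carrier_mat r n" and P: "P = L * R"
    and redL: "left_invertible L" "col_reduced \<delta> L"
    and redR: "left_invertible (transpose_mat R)" "col_reduced \<epsilon> (transpose_mat R)"
    and sum: "\<And>i. i < r \<Longrightarrow> \<delta> i + \<epsilon> i = d"
    using reduced_factorization_exists[of P m n d r] assms by metis
  have tR: "transpose_mat R \<in> carrier_mat n r" using R by simp
  have "vec_deg (col L i) + vec_deg (row R i) = ereal (real d)" if "i < r" for i
    using col_reduced_vec_deg[OF L redL(2) that] col_reduced_vec_deg[OF tR redR(2) that] sum[OF that] R that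
    by auto
  \<comment> \<open>The rows of \<open>R\<close> are treated throughout as the columns of its
    transpose.\<close>
  moreover have "minimal_basis n (rows R)" 
    using minimal_basis_if_col_reduced[OF tR redR] by simp
  ultimately show ?factorization
    using L R P minimal_basis_if_col_reduced[OF L redL] by blast
next
  assume ?factorization
  then obtain L R where L: "L \<in> carrier_mat m r" and R: "R \<in> carrier_mat r n" and P: "P = L * R"
    and min: "minimal_basis m (cols L)" "minimal_basis n (rows R)"
    and deg: "\<And>i. i < r \<Longrightarrow> vec_deg (col L i) + vec_deg (row R i) = ereal (real d)" by blast
  have tR: "transpose_mat R \<in> carrier_mat n r" using R by simp
  obtain \<delta> where redL: "left_invertible L" "col_reduced \<delta> L"
    using minimal_basis_imp_col_reduced[OF L min(1)] by blast
  obtain \<epsilon> where redR: "left_invertible (transpose_mat R)" "col_reduced \<epsilon> (transpose_mat R)"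
    using minimal_basis_imp_col_reduced[OF tR] min(2) by auto
  \<comment> \<open>The \<delta> and \<epsilon> obtained from reducedness are the exact column and
    row degrees, so the degree condition on the bases carries over to them.\<close>
  have "\<delta> i + \<epsilon> i = d" if "i < r" for i
  proof -
    have "ereal (real (\<delta> i)) + ereal (real (\<epsilon> i)) = ereal (real d)"
      using deg[OF that] col_reduced_vec_deg[OF L redL(2) that] col_reduced_vec_deg[OF tR redR(2) that] R that
      by simp
    then show ?thesis by (simp flip: of_nat_add)
  qed
  then show ?spectral
    using no_eigenvalues_of_reduced_factorization[OF L R \<open>0 < r\<close> redL redR] assms(5) unfolding P by blast
qed

end
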